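(* Let $n,m,k$ be positive integers with $n>m\ge k\ge 2$. Then for every design $(A,c)$ with $A\in\mathbb{R}_{\ge 0}^{m\times n}$ and $c\in\mathbb{R}_{\ge 0}^n$, the number of $k$-loadouts satisfies $$|\mathcal{L}^k(A,c)|\le f_{k-1}(\mathcal{C}(n+1,m))-\binom{m}{k-1}.$$
   Context: For $A\in\mathbb{R}_{\ge0}^{m\times n}$, $c\in\mathbb{R}_{\ge0}^n$, $b\in\mathbb{R}_{\ge0}^m$, let $LP(A,c,b)$ be the linear program $\max\{c^\top x \mid Ax\le b,\ x\ge 0\}$. The pair $(A,c)$ is called a design. For $x\in\mathbb{R}^n_{\ge0}$, $\mathrm{supp}(x)=\{i\in[n]\mid x_i>0\}$, where $[n]=\{1,\dots,n\}$. A set $L\subseteq[n]$ is a loadout of $(A,c)$ if there exists $b\in\mathbb{R}^m_{\ge 0}$ such that $LP(A,c,b)$ has a unique optimal solution $x^*$ and $\mathrm{supp}(x^* )=L$. A loadout with $|L|=k$ is a $k$-loadout, and $\mathcal{L}^k(A,c)$ is the set of all $k$-loadouts of $(A,c)$. The cyclic polytope $\mathcal{C}(N,d)$ is the convex hull of $N$ distinct points on the moment curve $t\mapsto(t,t^2,\dots,t^d)$ in $\mathbb{R}^d$ (its combinatorial type does not depend on the choice of points). For a polytope $P$, $f_i(P)$ denotes the number of $i$-dimensional faces of $P$. *)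

theory Defs
  imports "HOL-Analysis.Analysis"
begin

text \<open>
  The dimensions are the cardinalities of the finite index types: a matrix with m rows and n
  columns has type \<^typ>\<open>real ^ 'n ^ 'm\<close>, with m = \<open>CARD('m)\<close> and n = \<open>CARD('n)\<close>, and the
  index set [n] is the type \<open>'n\<close>.  The orders on vectors and matrices are componentwise.
\<close>

definition design :: "real ^ 'n ^ 'm \<Rightarrow> real ^ 'n \<Rightarrow> bool" where
  "design A c \<longleftrightarrow> 0 \<le> A \<and> 0 \<le> c"

definition lp_feasible :: "real ^ 'n ^ 'm \<Rightarrow> real ^ 'm \<Rightarrow> (real ^ 'n) set" where
  "lp_feasible A b = {x. A *v x \<le> b \<and> 0 \<le> x}"

definition lp_optimal :: "real ^ 'n ^ 'm \<Rightarrow> real ^ 'n \<Rightarrow> real ^ 'm \<Rightarrow> (real ^ 'n) set" where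
  "lp_optimal A c b = {x \<in> lp_feasible A b. \<forall>y \<in> lp_feasible A b. c \<bullet> y \<le> c \<bullet> x}"

definition supp :: "real ^ 'n \<Rightarrow> 'n set" where
  "supp x = {i. x $ i > 0}"

definition loadout :: "real ^ 'n ^ 'm \<Rightarrow> real ^ 'n \<Rightarrow> 'n set \<Rightarrow> bool" where
  "loadout A c L \<longleftrightarrow> (\<exists>b \<ge> 0. \<exists>x. lp_optimal A c b = {x} \<and> supp x = L)"

definition loadouts :: "nat \<Rightarrow> real ^ 'n ^ 'm \<Rightarrow> real ^ 'n \<Rightarrow> 'n set set" where
  "loadouts k A c = {L. loadout A c L \<and> card L = k}"

text \<open>
  As the coordinates of \<^typ>\<open>real ^ 'd\<close> carry no order, the moment curve is taken with respect to
  a numbering \<open>e\<close> of them by 1, ..., d.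
\<close>

definition moment_curve :: "('d \<Rightarrow> nat) \<Rightarrow> real \<Rightarrow> real ^ 'd" where
  "moment_curve e t = (\<chi> i. t ^ e i)"

text \<open>
  A predicate rather than a function, because the polytope depends on the chosen points on the
  curve; only its combinatorial type does not.
\<close>

definition cyclic_polytope :: "nat \<Rightarrow> (real ^ 'd) set \<Rightarrow> bool" where
  "cyclic_polytope N P \<longleftrightarrow>
     (\<exists>e T. bij_betw e (UNIV :: 'd set) {1..CARD('d)} \<and> finite T \<and> card T = N \<and>
        P = convex hull (moment_curve e ` T))"

definition face_count :: "nat \<Rightarrow> 'a :: euclidean_space set \<Rightarrow> nat" where
  "face_count i P = card {F. F face_of P \<and> aff_dim F = int i}"

end

theory Submission
  imports Defs "HOL-Library.Multiset" "HOL-Computational_Algebra.Polynomial"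
begin

text \<open>
  By strict complementarity a loadout \<open>L\<close> is a set of constraints \<open>column j A \<bullet> y \<ge> c $ j\<close> that are
  tight together, all others being strict.  This property survives small perturbations, so the
  constraints may be assumed to be in general position; homogenised with one further constraint at
  infinity they form a configuration of \<open>n + 1\<close> vectors in dimension \<open>m + 1\<close>, that is, a simple
  \<open>m\<close>-polytope with \<open>n + 1\<close> facets (dually, a simplicial polytope with \<open>n + 1\<close> vertices).  Loadouts
  become faces that avoid the vertex at infinity, and at least \<open>m choose (k - 1)\<close> faces contain it.

  What remains is the upper bound theorem.  Every face has a unique vertex that minimises a generic
  objective, so the face numbers are determined by the number of objective-decreasing edges at each
  vertex, both for the objective and for its negation.  At most \<open>(n + 1 - m + i) choose i\<close> vertices
  have at most \<open>i\<close> decreasing edges, by the skew version of Bollobas's set pair inequality (the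
  argument of Alon and Kalai), and neighborly polytopes, such as the cyclic ones, attain all these
  bounds up to \<open>i = m div 2\<close>.  Averaging the counts for the objective and its negation makes the
  Dehn-Sommerville equations unnecessary.
\<close>

section \<open>Combinatorial preliminaries\<close>

text \<open>Gaussian elimination, one equation per induction step. Unknowns and equations are
  indexed by arbitrary finite sets, so that facets can serve as unknowns and multisets as
  equations.\<close>

lemma homogeneous_system_nontrivial_solution:
  fixes M :: "'a \<Rightarrow> 'b \<Rightarrow> real"
  assumes "finite E" "finite S" "card E < card S"
  shows "\<exists>l. (\<exists>v\<in>S. l v \<noteq> 0) \<and> (\<forall>e\<in>E. (\<Sum>v\<in>S. l v * M v e) = 0)"
  using assms
proof (induction E arbitrary: S M rule: finite_induct)
  case empty
  then obtain v where "v \<in> S" by fastforce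
  then show ?case by (intro exI[of _ "\<lambda>_. 1"]) auto
next
  case (insert e E)
  show ?case
  proof (cases "\<forall>v\<in>S. M v e = 0")
    case True
    from insert.IH[of S M] insert.prems insert.hyps obtain l where
      "\<exists>v\<in>S. l v \<noteq> 0" "\<forall>e\<in>E. (\<Sum>v\<in>S. l v * M v e) = 0" by auto
    with True show ?thesis by (intro exI[of _ l]) auto
  next
    case False
    then obtain p where p: "p \<in> S" "M p e \<noteq> 0" by auto
    \<comment> \<open>Unknown \<open>p\<close> is eliminated through equation \<open>e\<close>: in
      \<open>M'\<close> this equation becomes trivial, and the value \<open>l' p\<close> below
      restores it in \<open>M\<close>.\<close>
    define M' where "M' v f = M v f - M v e / M p e * M p f" for v f
    have "card E < card (S - {p})" using insert p by auto
    from insert.IH[of "S - {p}" M'] this insert.prems obtain l where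
      l: "\<exists>v\<in>S - {p}. l v \<noteq> 0" "\<forall>f\<in>E. (\<Sum>v\<in>S - {p}. l v * M' v f) = 0" by auto
    define l' where
      "l' v = (if v = p then - (\<Sum>v\<in>S - {p}. l v * M v e / M p e) else l v)" for v
    have eq: "(\<Sum>v\<in>S. l' v * M v f) = (\<Sum>v\<in>S - {p}. l v * M' v f)" for f
    proof -
      have "(\<Sum>v\<in>S. l' v * M v f) = l' p * M p f + (\<Sum>v\<in>S - {p}. l' v * M v f)"
        using insert.prems p by (simp add: sum.remove)
      also have "(\<Sum>v\<in>S - {p}. l' v * M v f) = (\<Sum>v\<in>S - {p}. l v * M v f)"
        by (rule sum.cong) (auto simp: l'_def)
      finally show ?thesis
        by (simp add: M'_def l'_def algebra_simps sum_subtractf sum_distrib_left sum_distrib_right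
              sum_negf)
    qed
    have "M' v e = 0" for v using p by (simp add: M'_def)
    then have "\<forall>f\<in>insert e E. (\<Sum>v\<in>S. l' v * M v f) = 0" using l(2) eq by simp
    moreover have "\<exists>v\<in>S. l' v \<noteq> 0" using l(1) by (auto simp: l'_def)
    ultimately show ?thesis by blast
  qed
qed

text \<open>
  Evaluating the polynomial with roots \<open>t ` R y\<close> on \<open>t ` C x\<close> and multiplying gives a matrix that is
  triangular with nonzero diagonal.  Expanding the product, it factors through the multisets of
  \<open>s\<close> exponents from \<open>{..i}\<close>, which bounds its rank.
\<close>

lemma skew_set_pairs_bound:
  fixes R C :: "'b \<Rightarrow> 'a set" and \<mu> :: "'b \<Rightarrow> real"
  assumes "finite F"
    and finR: "\<And>x. x \<in> F \<Longrightarrow> finite (R x)" and finC: "\<And>x. x \<in> F \<Longrightarrow> finite (C x)"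
    and cardR: "\<And>x. x \<in> F \<Longrightarrow> card (R x) \<le> i" and cardC: "\<And>x. x \<in> F \<Longrightarrow> card (C x) = s"
    and disj: "\<And>x. x \<in> F \<Longrightarrow> R x \<inter> C x = {}"
    and skew: "\<And>x y. x \<in> F \<Longrightarrow> y \<in> F \<Longrightarrow> x \<noteq> y \<Longrightarrow> R y \<inter> C x = {} \<Longrightarrow> \<mu> y < \<mu> x"
  shows "card F \<le> (s + i) choose i"
proof (rule ccontr)
  assume contr: "\<not> card F \<le> (s + i) choose i"
  define W where "W = (\<Union>x\<in>F. R x \<union> C x)"
  have finW: "finite W" using assms by (auto simp: W_def)
  then obtain t0 :: "'a \<Rightarrow> nat" where t0: "inj_on t0 W"
    using finite_imp_inj_to_nat_seg by blast
  define t :: "'a \<Rightarrow> real" where "t v = real (t0 v)" for v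
  have t: "inj_on t W" using t0 by (auto simp: inj_on_def t_def)
  define X where "X y = (\<Prod>l\<in>R y. [:- t l, 1:])" for y
  have polyX: "poly (X y) a = (\<Prod>l\<in>R y. a - t l)" for y a
    by (simp add: X_def poly_prod)
  have degX: "degree (X y) \<le> i" if "y \<in> F" for y
  proof -
    have "degree (X y) \<le> (\<Sum>l\<in>R y. degree [:- t l, 1:])"
      unfolding X_def using degree_prod_sum_le[OF finR[OF that], of "\<lambda>l. [:- t l, 1:]"] by (simp add: o_def)
    also have "\<dots> = card (R y)" by simp
    finally show ?thesis using cardR[OF that] by simp
  qed
  define Q where "Q x y = (\<Prod>j\<in>C x. poly (X y) (t j))" for x y
  have Q0: "Q x y = 0 \<longleftrightarrow> R y \<inter> C x \<noteq> {}" if "x \<in> F" "y \<in> F" for x y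
  proof -
    have "Q x y = 0 \<longleftrightarrow> (\<exists>j\<in>C x. \<exists>l\<in>R y. t j = t l)"
      using finR[OF that(2)] finC[OF that(1)] by (auto simp: Q_def polyX prod_zero_iff)
    also have "\<dots> \<longleftrightarrow> R y \<inter> C x \<noteq> {}"
    proof -
      have "t j = t l \<longleftrightarrow> j = l" if "j \<in> C x" "l \<in> R y" for j l
        using that \<open>x \<in> F\<close> \<open>y \<in> F\<close> by (intro inj_on_eq_iff[OF t]) (auto simp: W_def)
      then show ?thesis by blast
    qed
    finally show ?thesis .
  qed
  define MS :: "nat multiset set" where "MS = multisets_of_size {..i} s"
  have finMS: "finite MS" unfolding MS_def by auto
  have cardMS: "card MS = (s + i) choose i"
    unfolding MS_def using binomial_symmetric[of s "s + i"]
    by (subst card_multisets_of_size) (auto simp: add.commute)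
  \<comment> \<open>Expanding \<open>Q x y\<close> chooses one exponent for each element of
    \<open>C x\<close>. The product of the coefficients depends only on the multiset of these
    exponents, which separates \<open>y\<close> (in \<open>c\<close>) from \<open>x\<close> (in
    \<open>K\<close>).\<close>
  define c where "c y M = (\<Prod>e\<in>#M. coeff (X y) e)" for y M
  define ty :: "'b \<Rightarrow> ('a \<Rightarrow> nat) \<Rightarrow> nat multiset" where
    "ty x g = image_mset g (mset_set (C x))" for x g
  define G where "G x = PiE (C x) (\<lambda>_. {..i})" for x
  define K where "K x M = (\<Sum>g\<in>{g\<in>G x. ty x g = M}. \<Prod>j\<in>C x. t j ^ g j)" for x M
  have factor: "Q x y = (\<Sum>M\<in>MS. c y M * K x M)" if x: "x \<in> F" and y: "y \<in> F" for x y
  proof -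
    have finG: "finite (G x)" unfolding G_def using finC[OF x] by (intro finite_PiE) auto
    have "poly (X y) a = (\<Sum>e\<le>i. coeff (X y) e * a ^ e)" for a
      unfolding poly_altdef using degX[OF y]
      by (intro sum.mono_neutral_left) (auto simp: coeff_eq_0)
    then have "Q x y = (\<Prod>j\<in>C x. \<Sum>e\<le>i. coeff (X y) e * t j ^ e)"
      unfolding Q_def by simp
    also have "\<dots> = (\<Sum>g\<in>G x. \<Prod>j\<in>C x. coeff (X y) (g j) * t j ^ g j)"
      unfolding G_def using finC[OF x] by (intro prod_sum_PiE) auto
    also have "\<dots> = (\<Sum>g\<in>G x. c y (ty x g) * (\<Prod>j\<in>C x. t j ^ g j))"
      by (intro sum.cong refl)
        (simp add: prod.distrib c_def ty_def image_mset.compositionality o_def prod_unfold_prod_mset)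
    also have "\<dots> = (\<Sum>M\<in>MS. \<Sum>g\<in>{g\<in>G x. ty x g = M}. c y (ty x g) * (\<Prod>j\<in>C x. t j ^ g j))"
    proof (rule sum.group[symmetric])
      show "ty x ` G x \<subseteq> MS"
        using finC[OF x] cardC[OF x] by (auto simp: MS_def multisets_of_size_def ty_def G_def)
    qed (use finG finMS in auto)
    also have "\<dots> = (\<Sum>M\<in>MS. c y M * K x M)"
      unfolding K_def sum_distrib_left by (intro sum.cong refl) auto
    finally show ?thesis .
  qed
  have "card MS < card F" using contr cardMS by simp
  from homogeneous_system_nontrivial_solution[OF finMS \<open>finite F\<close> this, of c] obtain l where
    l: "\<exists>y\<in>F. l y \<noteq> 0" "\<forall>M\<in>MS. (\<Sum>y\<in>F. l y * c y M) = 0" by auto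
  have zero: "(\<Sum>y\<in>F. l y * Q x y) = 0" if "x \<in> F" for x
  proof -
    have "(\<Sum>y\<in>F. l y * Q x y) = (\<Sum>y\<in>F. \<Sum>M\<in>MS. l y * c y M * K x M)"
      by (intro sum.cong refl) (simp add: factor[OF that] sum_distrib_left mult.assoc)
    also have "\<dots> = (\<Sum>M\<in>MS. (\<Sum>y\<in>F. l y * c y M) * K x M)"
      by (subst sum.swap) (simp add: sum_distrib_right)
    also have "\<dots> = 0" using l(2) by simp
    finally show ?thesis .
  qed
  define D where "D = {y\<in>F. l y \<noteq> 0}"
  have "finite D" "D \<noteq> {}" using l(1) \<open>finite F\<close> by (auto simp: D_def)
  \<comment> \<open>At the smallest \<mu> in the support of the dependency, skewness forces
    \<open>Q x y = 0\<close> for every other \<open>y\<close> in \<open>D\<close>, so row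
    \<open>x\<close> reduces to its nonzero diagonal entry.\<close>
  then obtain x where x: "x \<in> D" "\<forall>y\<in>D. \<mu> x \<le> \<mu> y"
    by (metis arg_min_if_finite(1) arg_min_least)
  have xF: "x \<in> F" "l x \<noteq> 0" using x by (auto simp: D_def)
  have "l y * Q x y = 0" if "y \<in> F - {x}" for y
  proof (cases "y \<in> D")
    case True
    then have "\<not> \<mu> y < \<mu> x" using x by force
    then show ?thesis using skew[of x y] Q0[of x y] that xF by auto
  qed (use that in \<open>auto simp: D_def\<close>)
  then have "(\<Sum>y\<in>F. l y * Q x y) = l x * Q x x"
    using \<open>finite F\<close> xF by (simp add: sum.remove[of _ x] sum.neutral)
  then show False using zero[OF xF(1)] Q0[of x x] disj[OF xF(1)] xF by simp
qed

section \<open>Binomial convolution and summation by parts\<close>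

text \<open>Pascal's rule in the first factor splits the sum into the cases
  \<open>(a - 1, b, j)\<close> and \<open>(a, b - 1, j - 1)\<close>, hence the induction on
  \<open>a + j\<close>. With \<open>b = m\<close>, h-numbers \<open>(a + i) choose i\<close> thus
  give as many faces of size \<open>j\<close> as there are \<open>j\<close>-subsets of
  \<open>a + m + 1\<close> vertices.\<close>

lemma sum_binomial_convolution:
  assumes "j \<le> b"
  shows "(\<Sum>i\<le>j. ((a + i) choose i) * ((b - i) choose (j - i))) = (a + b + 1) choose j"
  using assms
proof (induction "a + j" arbitrary: a b j rule: less_induct)
  case less
  show ?case
  proof (cases "a = 0 \<or> j = 0")
    case True
    then show ?thesis using sum_choose_diagonal[OF less.prems] by auto
  next
    case False
    then obtain a' j' where a: "a = Suc a'" and j: "j = Suc j'" by (metis not0_implies_Suc)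
    obtain b' where b: "b = Suc b'" using less.prems j by (cases b) auto
    have 1: "(\<Sum>i\<le>j. ((a' + i) choose i) * ((b - i) choose (j - i))) = (a' + b + 1) choose j"
      using less.hyps[of a' j b] less.prems a by auto
    have 2: "(\<Sum>i\<le>j'. ((a + i) choose i) * ((b' - i) choose (j' - i))) = (a + b' + 1) choose j'"
      using less.hyps[of a j' b'] less.prems j b by auto
    have "(\<Sum>i\<le>j. ((a + i) choose i) * ((b - i) choose (j - i))) =
        (b choose j) + (\<Sum>i\<le>j'. ((a + Suc i) choose Suc i) * ((b' - i) choose (j' - i)))"
      unfolding j sum.atMost_Suc_shift by (simp add: b)
    also have "\<dots> = (b choose j) + (\<Sum>i\<le>j'. ((a' + Suc i) choose Suc i) * ((b' - i) choose (j' - i)))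
        + (\<Sum>i\<le>j'. ((a + i) choose i) * ((b' - i) choose (j' - i)))"
      by (simp add: a distrib_right sum.distrib)
    also have "(b choose j) + (\<Sum>i\<le>j'. ((a' + Suc i) choose Suc i) * ((b' - i) choose (j' - i)))
        = (\<Sum>i\<le>j. ((a' + i) choose i) * ((b - i) choose (j - i)))"
      unfolding j sum.atMost_Suc_shift by (simp add: b)
    finally show ?thesis unfolding 1 2 by (simp add: a j b)
  qed
qed

text \<open>Summation by parts. The induction carries the boundary term of the partial sums as a
  lower bound; at \<open>q = p\<close> this term is nonnegative.\<close>

lemma sum_mult_antimono_le:
  fixes h h' \<psi> :: "nat \<Rightarrow> real"
  assumes partial: "\<And>j. j \<le> p \<Longrightarrow> sum h {..j} \<le> sum h' {..j}"
    and anti: "\<And>j. j < p \<Longrightarrow> \<psi> (Suc j) \<le> \<psi> j" and "\<psi> p \<ge> 0"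
  shows "(\<Sum>j\<le>p. h j * \<psi> j) \<le> (\<Sum>j\<le>p. h' j * \<psi> j)"
proof -
  have "(sum h' {..q} - sum h {..q}) * \<psi> q \<le> (\<Sum>j\<le>q. (h' j - h j) * \<psi> j)" if "q \<le> p" for q
    using that
  proof (induction q)
    case (Suc q)
    have "(sum h' {..q} - sum h {..q}) * \<psi> (Suc q) \<le> (sum h' {..q} - sum h {..q}) * \<psi> q"
      using Suc.prems partial[of q] anti[of q] by (intro mult_left_mono) auto
    also have "\<dots> \<le> (\<Sum>j\<le>q. (h' j - h j) * \<psi> j)" using Suc by simp
    finally show ?case by (simp add: algebra_simps)
  qed (simp add: algebra_simps)
  from this[of p] partial[of p] \<open>\<psi> p \<ge> 0\<close>
  have "0 \<le> (\<Sum>j\<le>p. (h' j - h j) * \<psi> j)"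
    by (meson diff_ge_0_iff_ge dual_order.trans le_refl mult_nonneg_nonneg)
  then show ?thesis by (simp add: left_diff_distrib sum_subtractf)
qed

section \<open>Vector configurations and their faces\<close>

text \<open>General position in homogeneous form: \<open>generic\<close> says that any
  \<open>Suc m\<close> of the vectors span the space. The vectors \<open>z\<close> are normals of
  hyperplanes, or dually points of the cone cut out by
  \<open>u j \<bullet> z \<ge> 0\<close>.\<close>

locale vector_config =
  fixes V :: "'v set" and u :: "'v \<Rightarrow> 'e::euclidean_space" and m :: nat
  assumes finite_V: "finite V"
    and dim_eq: "DIM('e) = Suc m"
    and card_V: "Suc m \<le> card V"
    and generic: "S \<subseteq> V \<Longrightarrow> card S = Suc m \<Longrightarrow> (\<And>j. j \<in> S \<Longrightarrow> u j \<bullet> z = 0) \<Longrightarrow> z = 0"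
begin

text \<open>Faces are recorded by index sets: \<open>z\<close> supports the configuration exactly in
  \<open>L\<close>. Dually, \<open>L\<close> is the set of constraints tight at the point
  \<open>z\<close> of the dual cone, so larger \<open>L\<close> means smaller dual faces.\<close>

definition face :: "'v set \<Rightarrow> bool" where
  "face L \<longleftrightarrow> L \<subseteq> V \<and> (\<exists>z. (\<forall>j\<in>L. u j \<bullet> z = 0) \<and> (\<forall>j\<in>V - L. u j \<bullet> z > 0))"

definition facet :: "'v set \<Rightarrow> bool" where
  "facet B \<longleftrightarrow> face B \<and> card B = m"

text \<open>A functional that is positive on all nonzero points of the dual cone; it normalises
  these points to the slice \<open>p \<bullet> z = 1\<close>.\<close>

definition p :: 'e where "p = (\<Sum>j\<in>V. u j)"

text \<open>At most \<open>Suc m\<close> of the vectors are linearly independent, as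
  \<open>S\<close> extends to a spanning set of size \<open>Suc m\<close>. So the values extend to a
  linear functional, which is an inner product with some \<open>z\<close>.\<close>

lemma ex_prescribed:
  assumes "S \<subseteq> V" "card S \<le> Suc m"
  shows "\<exists>z. \<forall>j\<in>S. u j \<bullet> z = g j"
proof -
  obtain S' where S': "S \<subseteq> S'" "S' \<subseteq> V" "card S' = Suc m"
    using exists_subset_between[of S "Suc m" V] assms card_V finite_V by auto
  have fS': "finite S'" using S' finite_V finite_subset by blast
  have "\<not> dim (u ` S') < DIM('e)"
  proof
    assume "dim (u ` S') < DIM('e)"
    from orthogonal_to_subspace_exists[OF this] obtain x where
      x: "x \<noteq> 0" "\<And>y. y \<in> span (u ` S') \<Longrightarrow> orthogonal x y" by auto
    have "x = 0"
    proof (rule generic[OF S'(2,3)])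
      fix j assume "j \<in> S'"
      then have "orthogonal x (u j)" by (intro x(2) span_base imageI)
      then show "u j \<bullet> x = 0" by (simp add: orthogonal_def inner_commute)
    qed
    with x show False by simp
  qed
  then have d: "Suc m \<le> dim (u ` S')" using dim_eq by simp
  have c: "dim (u ` S') \<le> card (u ` S')" "card (u ` S') \<le> card S'"
    using fS' by (auto intro: dim_le_card' card_image_le)
  have inj: "inj_on u S'" using c d S'(3) fS' by (intro eq_card_imp_inj_on) auto
  have indep: "independent (u ` S')"
    using c d S'(3) fS' by (intro card_le_dim_spanning[of _ "u ` S'"]) (auto intro: span_base)
  from linear_independent_extend[OF indep, of "\<lambda>x. g (inv_into S' u x)"]
  obtain f :: "'e \<Rightarrow> real" where f: "linear f" "\<forall>x\<in>u ` S'. f x = g (inv_into S' u x)" by auto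
  define z where "z = (\<Sum>b\<in>Basis. f b *\<^sub>R b)"
  have "x \<bullet> z = f x" for x
  proof -
    have "f x = f (\<Sum>b\<in>Basis. (x \<bullet> b) *\<^sub>R b)" by (simp add: euclidean_representation)
    also have "\<dots> = (\<Sum>b\<in>Basis. (x \<bullet> b) * f b)" using f(1) by (simp add: linear_sum linear_cmul)
    also have "\<dots> = x \<bullet> z" by (simp add: z_def inner_sum_right mult.commute)
    finally show ?thesis by simp
  qed
  then show ?thesis using f(2) inj S'(1) by (intro exI[of _ z]) auto
qed

lemma card_zero_set_le:
  assumes "z \<noteq> 0"
  shows "card {j\<in>V. u j \<bullet> z = 0} \<le> m"
proof (rule ccontr)
  assume "\<not> card {j\<in>V. u j \<bullet> z = 0} \<le> m"
  then have "Suc m \<le> card {j\<in>V. u j \<bullet> z = 0}" by simp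
  then obtain S where "S \<subseteq> {j\<in>V. u j \<bullet> z = 0}" "card S = Suc m"
    by (rule obtain_subset_with_card_n) blast
  then have "z = 0" by (intro generic[of S]) auto
  with assms show False by simp
qed

lemma all_zero_imp_zero:
  assumes "\<And>j. j \<in> V \<Longrightarrow> u j \<bullet> z = 0"
  shows "z = 0"
proof (rule ccontr)
  assume "z \<noteq> 0"
  moreover have "{j\<in>V. u j \<bullet> z = 0} = V" using assms by blast
  ultimately have "card V \<le> m" using card_zero_set_le by metis
  then show False using card_V by simp
qed

lemma p_inner: "p \<bullet> z = (\<Sum>j\<in>V. u j \<bullet> z)"
  by (simp add: p_def inner_sum_left)

lemma p_pos:
  assumes "z \<noteq> 0" "\<And>j. j \<in> V \<Longrightarrow> u j \<bullet> z \<ge> 0"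
  shows "p \<bullet> z > 0"
proof -
  have "p \<bullet> z \<noteq> 0"
    using assms all_zero_imp_zero[of z] sum_nonneg_eq_0_iff[OF finite_V, of "\<lambda>j. u j \<bullet> z"]
    by (auto simp: p_inner)
  moreover have "p \<bullet> z \<ge> 0" unfolding p_inner using assms by (intro sum_nonneg)
  ultimately show ?thesis by simp
qed

lemma face_zero_set:
  assumes "\<And>j. j \<in> V \<Longrightarrow> u j \<bullet> z \<ge> 0"
  shows "face {j\<in>V. u j \<bullet> z = 0}"
  unfolding face_def using assms by (intro conjI exI[of _ z]) (auto simp: less_le)

text \<open>The ratio test of the simplex method. By \<open>p_pos\<close> a nonzero \<open>d\<close>
  with \<open>p \<bullet> d = 0\<close> lies outside the dual cone, so some constraint decreases
  along \<open>d\<close>; the first one to become tight is \<open>i\<close>. Constraints tight at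
  \<open>z\<close> do not decrease, hence \<open>t > 0\<close>.\<close>

lemma ratio_test:
  assumes z: "\<And>j. j \<in> V \<Longrightarrow> u j \<bullet> z \<ge> 0" and d: "d \<noteq> 0" "p \<bullet> d = 0"
    and tight: "\<And>j. j \<in> V \<Longrightarrow> u j \<bullet> z = 0 \<Longrightarrow> u j \<bullet> d \<ge> 0"
  obtains t i where "t > 0" "\<forall>j\<in>V. u j \<bullet> (z + t *\<^sub>R d) \<ge> 0"
    "i \<in> V" "u i \<bullet> z > 0" "u i \<bullet> (z + t *\<^sub>R d) = 0"
proof -
  define D where "D = {j\<in>V. u j \<bullet> d < 0}"
  have "D \<noteq> {}" using p_pos[OF d(1)] d(2) by (auto simp: D_def not_less)
  moreover have "finite D" using finite_V by (simp add: D_def)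
  moreover define r where "r j = (u j \<bullet> z) / - (u j \<bullet> d)" for j
  ultimately obtain i where i: "i \<in> D" "\<And>j. j \<in> D \<Longrightarrow> r i \<le> r j"
    by (metis arg_min_if_finite(1) arg_min_least)
  have pos: "u j \<bullet> z > 0" if "j \<in> D" for j
    using that z[of j] tight[of j] by (force simp: D_def less_le)
  have "r i > 0" using i(1) pos[OF i(1)] by (simp add: r_def D_def divide_pos_neg)
  have nonneg: "u j \<bullet> (z + r i *\<^sub>R d) \<ge> 0" if j: "j \<in> V" for j
  proof (cases "j \<in> D")
    case True
    then have "- (u j \<bullet> d) > 0" by (simp add: D_def)
    then have "r i * - (u j \<bullet> d) \<le> u j \<bullet> z"
      using i(2)[OF True] unfolding r_def[of j] by (subst (asm) pos_le_divide_eq)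
    then show ?thesis by (simp add: inner_add_right)
  next
    case False
    then show ?thesis using j z[of j] \<open>r i > 0\<close> by (simp add: D_def inner_add_right)
  qed
  have "u i \<bullet> (z + r i *\<^sub>R d) = 0" and "i \<in> V"
    using i(1) by (simp_all add: D_def r_def inner_diff_right)
  with that[OF \<open>r i > 0\<close>] nonneg pos[OF i(1)] show thesis by simp
qed

text \<open>Simpliciality: a small tilt of the normal by a vector that is 0 on \<open>L\<close> and
  1 on \<open>B - L\<close> releases the constraints in \<open>B - L\<close> and keeps all strict
  ones strict.\<close>

lemma face_subset:
  assumes "face B" "card B \<le> m" "L \<subseteq> B"
  shows "face L"
proof -
  from assms(1) obtain z where B: "B \<subseteq> V" and
    z: "\<And>j. j \<in> B \<Longrightarrow> u j \<bullet> z = 0" "\<And>j. j \<in> V - B \<Longrightarrow> u j \<bullet> z > 0"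
    by (auto simp: face_def)
  obtain d where d: "\<forall>j\<in>B. u j \<bullet> d = (if j \<in> L then 0 else 1)"
    using ex_prescribed[OF B, of "\<lambda>j. if j \<in> L then 0 else 1"] assms(2) by auto
  have "\<forall>j\<in>V - B. \<forall>\<^sub>F t in at_right 0. u j \<bullet> (z + t *\<^sub>R d) > 0"
  proof
    fix j assume "j \<in> V - B"
    have "((\<lambda>t. u j \<bullet> (z + t *\<^sub>R d)) \<longlongrightarrow> u j \<bullet> (z + 0 *\<^sub>R d)) (at_right 0)"
      by (intro tendsto_intros)
    then show "\<forall>\<^sub>F t in at_right 0. u j \<bullet> (z + t *\<^sub>R d) > 0"
      using z(2)[OF \<open>j \<in> V - B\<close>] by (intro order_tendstoD) auto
  qed
  then have "\<forall>\<^sub>F t in at_right 0. \<forall>j\<in>V - B. u j \<bullet> (z + t *\<^sub>R d) > 0"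
    using finite_V by (intro eventually_ball_finite) auto
  moreover have "\<forall>\<^sub>F t in at_right (0::real). t > 0" by (rule eventually_at_right_less)
  ultimately have "\<forall>\<^sub>F t in at_right 0. t > 0 \<and> (\<forall>j\<in>V - B. u j \<bullet> (z + t *\<^sub>R d) > 0)"
    by (rule eventually_conj[rotated])
  from eventually_happens'[OF _ this] obtain t where
    t: "t > 0" "\<forall>j\<in>V - B. u j \<bullet> (z + t *\<^sub>R d) > 0" by auto
  have "u j \<bullet> (z + t *\<^sub>R d) = 0" if "j \<in> L" for j
  proof -
    have "j \<in> B" using that assms(3) by blast
    then show ?thesis using z(1)[of j] bspec[OF d, of j] that by (simp add: inner_add_right)
  qed
  moreover have "u j \<bullet> (z + t *\<^sub>R d) > 0" if "j \<in> V - L" for j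
  proof (cases "j \<in> B")
    case True
    then show ?thesis using z(1)[of j] bspec[OF d, of j] that t(1) by (simp add: inner_add_right)
  next
    case False
    then show ?thesis using bspec[OF t(2), of j] that by blast
  qed
  ultimately show ?thesis using B assms(3) unfolding face_def by blast
qed

text \<open>While \<open>card L < m\<close>, some nonzero direction is orthogonal to
  \<open>p\<close> and to all vectors of \<open>L\<close>. Moving along it keeps \<open>L\<close>
  tight until a further constraint becomes tight, and general position caps the number of tight
  constraints at \<open>m\<close>.\<close>

lemma face_extend:
  assumes "face L" "card L \<le> m"
  shows "\<exists>B. facet B \<and> L \<subseteq> B"
  using assms
proof (induction "m - card L" arbitrary: L rule: less_induct)
  case less
  show ?case
  proof (cases "card L = m")
    case True
    then show ?thesis using less.prems by (auto simp: facet_def)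
  next
    case False
    from less.prems obtain z where L: "L \<subseteq> V" and
      z: "\<And>j. j \<in> L \<Longrightarrow> u j \<bullet> z = 0" "\<And>j. j \<in> V - L \<Longrightarrow> u j \<bullet> z > 0"
      by (auto simp: face_def)
    have zge: "u j \<bullet> z \<ge> 0" if "j \<in> V" for j using z that by (cases "j \<in> L") (auto simp: less_imp_le)
    have "L \<noteq> V" using less.prems card_V by auto
    then obtain v where "v \<in> V - L" using L by blast
    then have "z \<noteq> 0" using z(2)[of v] by auto
    have fL: "finite L" using L finite_V finite_subset by blast
    have "dim (insert p (u ` L)) \<le> card (insert p (u ` L))" using fL by (intro dim_le_card') auto
    also have "\<dots> \<le> Suc (card L)"
      using fL card_image_le[OF fL, of u] by (simp add: card_insert_if)
    also have "\<dots> < DIM('e)" using False less.prems dim_eq by simp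
    finally obtain d where d: "d \<noteq> 0" "\<And>y. y \<in> span (insert p (u ` L)) \<Longrightarrow> orthogonal d y"
      using orthogonal_to_subspace_exists by blast
    have d0: "y \<bullet> d = 0" if "y \<in> insert p (u ` L)" for y
      using d(2)[OF span_base[OF that]] by (simp add: orthogonal_def inner_commute)
    then have pd: "p \<bullet> d = 0" by simp
    have tight: "u j \<bullet> d \<ge> 0" if "j \<in> V" "u j \<bullet> z = 0" for j
      using d0 z(2)[of j] that by (cases "j \<in> L") auto
    obtain t i where t: "t > 0" "\<forall>j\<in>V. u j \<bullet> (z + t *\<^sub>R d) \<ge> 0"
      and i: "i \<in> V" "u i \<bullet> z > 0" "u i \<bullet> (z + t *\<^sub>R d) = 0"
      by (rule ratio_test[OF zge d(1) pd tight])
    define L' where "L' = {j\<in>V. u j \<bullet> (z + t *\<^sub>R d) = 0}"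
    have "p \<bullet> (z + t *\<^sub>R d) > 0"
      using p_pos[OF \<open>z \<noteq> 0\<close> zge] pd by (simp add: inner_add_right)
    then have "z + t *\<^sub>R d \<noteq> 0" by (metis inner_zero_right less_irrefl)
    then have c: "card L' \<le> m" unfolding L'_def by (rule card_zero_set_le)
    have face: "face L'" unfolding L'_def using t by (intro face_zero_set) auto
    have "insert i L \<subseteq> L'" using i L z(1) d0 by (auto simp: L'_def inner_add_right)
    moreover have "i \<notin> L" using i z(1) by force
    moreover have "finite L'" using finite_V by (simp add: L'_def)
    ultimately have "card L < card L'" by (metis insert_subset psubsetI psubset_card_mono)
    moreover have "card L < m" using False less.prems by simp
    ultimately obtain B where "facet B" "L' \<subseteq> B"
      using less.hyps[of L'] c face by (meson diff_less_mono2)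
    then show ?thesis using \<open>insert i L \<subseteq> L'\<close> by auto
  qed
qed

text \<open>For a facet \<open>B\<close>, \<open>vertex B\<close> is the dual vertex, on the slice \<open>p \<bullet> z = 1\<close> of the dual cone, and
  \<open>edge B j\<close> the direction of the edge that leaves the \<open>j\<close>-th hyperplane.\<close>

definition vertex :: "'v set \<Rightarrow> 'e" where
  "vertex B = (SOME z. (\<forall>j\<in>B. u j \<bullet> z = 0) \<and> (\<forall>j\<in>V - B. u j \<bullet> z > 0) \<and> p \<bullet> z = 1)"

definition edge :: "'v set \<Rightarrow> 'v \<Rightarrow> 'e" where
  "edge B j = (SOME d. (\<forall>i\<in>B. u i \<bullet> d = (if i = j then 1 else 0)) \<and> p \<bullet> d = 0)"

section \<open>Dual vertices, edge directions and pivoting\<close>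

lemma facetD:
  assumes "facet B"
  shows "B \<subseteq> V" "finite B" "card B = m"
  using assms finite_V finite_subset by (auto simp: facet_def face_def)

lemma vertex:
  assumes "facet B"
  shows "\<And>j. j \<in> B \<Longrightarrow> u j \<bullet> vertex B = 0" and "\<And>j. j \<in> V - B \<Longrightarrow> u j \<bullet> vertex B > 0"
    and "\<And>j. j \<in> V \<Longrightarrow> u j \<bullet> vertex B \<ge> 0" and "p \<bullet> vertex B = 1"
proof -
  from assms obtain z where z: "\<forall>j\<in>B. u j \<bullet> z = 0" "\<forall>j\<in>V - B. u j \<bullet> z > 0"
    by (auto simp: facet_def face_def)
  have "B \<noteq> V" using facetD[OF assms] card_V by auto
  then obtain v where "v \<in> V - B" using facetD[OF assms] by blast
  then have "z \<noteq> 0" using z(2) by force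
  moreover have "u j \<bullet> z \<ge> 0" if "j \<in> V" for j
    using z that by (cases "j \<in> B") (auto simp: less_imp_le)
  ultimately have "p \<bullet> z > 0" by (rule p_pos)
  then have "\<exists>z. (\<forall>j\<in>B. u j \<bullet> z = 0) \<and> (\<forall>j\<in>V - B. u j \<bullet> z > 0) \<and> p \<bullet> z = 1"
    using z by (intro exI[of _ "(1 / (p \<bullet> z)) *\<^sub>R z"]) auto
  note * = someI_ex[OF this, folded vertex_def]
  then show "\<And>j. j \<in> B \<Longrightarrow> u j \<bullet> vertex B = 0" "\<And>j. j \<in> V - B \<Longrightarrow> u j \<bullet> vertex B > 0" "p \<bullet> vertex B = 1"
    by auto
  show "u j \<bullet> vertex B \<ge> 0" if "j \<in> V" for j
    using * that by (cases "j \<in> B") (auto simp: less_imp_le)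
qed

lemma edge:
  assumes "facet B"
  shows "\<And>i. i \<in> B \<Longrightarrow> u i \<bullet> edge B j = (if i = j then 1 else 0)" and "p \<bullet> edge B j = 0"
proof -
  obtain d where d: "\<forall>i\<in>B. u i \<bullet> d = (if i = j then 1 else 0)"
    using ex_prescribed[of B "\<lambda>i. if i = j then 1 else 0"] facetD[OF assms] by auto
  \<comment> \<open>\<open>vertex B\<close> is annihilated by all of \<open>B\<close> and has
    \<open>p\<close>-value 1, so subtracting a multiple of it corrects \<open>p \<bullet> d\<close>
    without changing the prescribed values.\<close>
  have "\<exists>d. (\<forall>i\<in>B. u i \<bullet> d = (if i = j then 1 else 0)) \<and> p \<bullet> d = 0"
    using d vertex(1,4)[OF assms]
    by (intro exI[of _ "d - (p \<bullet> d) *\<^sub>R vertex B"]) (auto simp: inner_diff_right)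
  note * = someI_ex[OF this, folded edge_def]
  show "\<And>i. i \<in> B \<Longrightarrow> u i \<bullet> edge B j = (if i = j then 1 else 0)"
    by (rule bspec[OF conjunct1[OF *]])
  show "p \<bullet> edge B j = 0" by (rule conjunct2[OF *])
qed

text \<open>Serves two ends: for \<open>d\<close> annihilated by all of \<open>B\<close> it produces
  too many tight constraints, a contradiction; for an edge direction it produces the neighbouring
  facet.\<close>

lemma facet_move:
  assumes B: "facet B" and d: "d \<noteq> 0" "p \<bullet> d = 0" and nonneg: "\<And>i. i \<in> B \<Longrightarrow> u i \<bullet> d \<ge> 0"
  obtains t i B' where "t > 0" "i \<in> V - B" "B' = {l\<in>V. u l \<bullet> (vertex B + t *\<^sub>R d) = 0}"
    "face B'" "card B' \<le> m" "insert i {l\<in>B. u l \<bullet> d = 0} \<subseteq> B'"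
proof -
  have tight: "u j \<bullet> d \<ge> 0" if "j \<in> V" "u j \<bullet> vertex B = 0" for j
    using nonneg vertex(2)[OF B, of j] that by (cases "j \<in> B") auto
  obtain t i where t: "t > 0" "\<forall>j\<in>V. u j \<bullet> (vertex B + t *\<^sub>R d) \<ge> 0"
    and i: "i \<in> V" "u i \<bullet> vertex B > 0" "u i \<bullet> (vertex B + t *\<^sub>R d) = 0"
    by (rule ratio_test[OF vertex(3)[OF B] d tight])
  define B' where "B' = {l\<in>V. u l \<bullet> (vertex B + t *\<^sub>R d) = 0}"
  have "p \<bullet> (vertex B + t *\<^sub>R d) = 1" using vertex(4)[OF B] d by (simp add: inner_add_right)
  then have "vertex B + t *\<^sub>R d \<noteq> 0" by (metis inner_zero_right zero_neq_one)
  then have c: "card B' \<le> m" unfolding B'_def by (rule card_zero_set_le)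
  have face: "face B'" unfolding B'_def using t by (intro face_zero_set) auto
  have iB: "i \<in> V - B" using i vertex(1)[OF B] by force
  have "insert i {l\<in>B. u l \<bullet> d = 0} \<subseteq> B'"
    using i facetD(1)[OF B] vertex(1)[OF B] by (auto simp: B'_def inner_add_right)
  with t(1) iB B'_def face c show thesis by (rule that)
qed

text \<open>\<open>vertex B\<close> and the edge directions form the basis dual to \<open>p\<close>
  and the \<open>u i\<close> with \<open>i \<in> B\<close>. A nonzero remainder \<open>d\<close>
  could be followed by \<open>facet_move\<close> to a face with more than \<open>m\<close>
  indices.\<close>

lemma decomp:
  assumes B: "facet B"
  shows "w \<bullet> x = (w \<bullet> vertex B) * (p \<bullet> x) + (\<Sum>i\<in>B. (w \<bullet> edge B i) * (u i \<bullet> x))"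
proof -
  note fin = facetD(2)[OF B]
  define d where "d = x - (p \<bullet> x) *\<^sub>R vertex B - (\<Sum>i\<in>B. (u i \<bullet> x) *\<^sub>R edge B i)"
  have pd: "p \<bullet> d = 0"
    using vertex(4)[OF B] edge(2)[OF B] by (simp add: d_def inner_diff_right inner_sum_right)
  have ud: "u l \<bullet> d = 0" if "l \<in> B" for l
  proof -
    have "(\<Sum>i\<in>B. (u i \<bullet> x) * (u l \<bullet> edge B i)) = (\<Sum>i\<in>B. if l = i then u i \<bullet> x else 0)"
      using edge(1)[OF B that] by (intro sum.cong refl) simp
    also have "\<dots> = u l \<bullet> x" using fin that by simp
    finally show ?thesis
      using vertex(1)[OF B that] by (simp add: d_def inner_diff_right inner_sum_right)
  qed
  have "d = 0"
  proof (rule ccontr)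
    assume "d \<noteq> 0"
    have nn: "\<And>i. i \<in> B \<Longrightarrow> u i \<bullet> d \<ge> 0" and eq: "{l\<in>B. u l \<bullet> d = 0} = B" using ud by auto
    obtain i B' where "i \<in> V - B" "face B'" "card B' \<le> m" "insert i B \<subseteq> B'"
      by (rule facet_move[OF B \<open>d \<noteq> 0\<close> pd nn, unfolded eq])
    moreover have "finite B'" using \<open>face B'\<close> finite_V finite_subset by (auto simp: face_def)
    ultimately show False using fin facetD(3)[OF B] card_mono[of B' "insert i B"] by auto
  qed
  then have "x = (p \<bullet> x) *\<^sub>R vertex B + (\<Sum>i\<in>B. (u i \<bullet> x) *\<^sub>R edge B i)"
    unfolding d_def by (simp only: diff_diff_eq right_minus_eq)
  then have "w \<bullet> x = w \<bullet> ((p \<bullet> x) *\<^sub>R vertex B + (\<Sum>i\<in>B. (u i \<bullet> x) *\<^sub>R edge B i))" by simp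
  then show ?thesis by (simp add: inner_add_right inner_sum_right mult.commute)
qed

text \<open>Along \<open>edge B j\<close> only \<open>j\<close> is released from \<open>B\<close>.
  The first constraint \<open>i\<close> to become tight replaces it, and the bound \<open>m\<close>
  excludes any further one.\<close>

lemma facet_pivot:
  assumes B: "facet B" and j: "j \<in> B"
  shows "\<exists>t>0. \<exists>i\<in>V - B. facet (insert i (B - {j})) \<and> vertex (insert i (B - {j})) = vertex B + t *\<^sub>R edge B j"
proof -
  have "edge B j \<noteq> 0" using edge(1)[OF B j, of j] by auto
  have nn: "\<And>i. i \<in> B \<Longrightarrow> u i \<bullet> edge B j \<ge> 0" using edge(1)[OF B] by auto
  obtain t i B' where t: "t > 0" and i: "i \<in> V - B"
    and B'_eq: "B' = {l\<in>V. u l \<bullet> (vertex B + t *\<^sub>R edge B j) = 0}"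
    and B': "face B'" "card B' \<le> m" "insert i {l\<in>B. u l \<bullet> edge B j = 0} \<subseteq> B'"
    by (rule facet_move[OF B \<open>edge B j \<noteq> 0\<close> edge(2)[OF B] nn])
  have "{l\<in>B. u l \<bullet> edge B j = 0} = B - {j}" using edge(1)[OF B] by auto
  then have sub: "insert i (B - {j}) \<subseteq> B'" using B'(3) by simp
  have "card (insert i (B - {j})) = m"
    using facetD[OF B] i j card_Suc_Diff1[of B j] by (simp del: card_Diff_insert)
  moreover have "finite B'" using finite_V B'_eq by simp
  ultimately have eq: "insert i (B - {j}) = B'" using sub B'(2) by (metis card_seteq)
  then have facet: "facet B'" using B' \<open>card (insert i (B - {j})) = m\<close> by (simp add: facet_def)
  define z where "z = vertex B + t *\<^sub>R edge B j"
  have pz: "p \<bullet> z = 1" using vertex(4)[OF B] edge(2)[OF B] by (simp add: z_def inner_add_right)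
  \<comment> \<open>Both points have \<open>p\<close>-value 1 and are annihilated by
    \<open>B'\<close>; \<open>decomp\<close> then shows that their difference is orthogonal to
    itself.\<close>
  have "vertex B' = z"
  proof (rule ccontr)
    assume "vertex B' \<noteq> z"
    have "u l \<bullet> (z - vertex B') = 0" if "l \<in> B'" for l
    proof -
      have "u l \<bullet> z = 0" using that unfolding B'_eq z_def by blast
      then show ?thesis using vertex(1)[OF facet that] by (simp add: inner_diff_right)
    qed
    moreover have "p \<bullet> (z - vertex B') = 0"
      using pz vertex(4)[OF facet] by (simp add: inner_diff_right)
    ultimately have "(z - vertex B') \<bullet> (z - vertex B') = 0"
      using decomp[OF facet, of "z - vertex B'" "z - vertex B'"] by (simp add: sum.neutral)
    with \<open>vertex B' \<noteq> z\<close> show False by simp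
  qed
  then show ?thesis using t i facet eq z_def by auto
qed

end

section \<open>The upper bound theorem\<close>

context vector_config
begin

section \<open>Generic objectives, h-numbers and face counts\<close>

text \<open>With the edges of the dual polytope oriented towards increasing \<open>w\<close>, these
  are the edges entering \<open>vertex B\<close>, each named by the constraint that it
  releases.\<close>

definition inset :: "'e \<Rightarrow> 'v set \<Rightarrow> 'v set" where
  "inset w B = {j\<in>B. w \<bullet> edge B j < 0}"

definition generic_objective :: "'e \<Rightarrow> bool" where
  "generic_objective w \<longleftrightarrow> (\<forall>B. facet B \<longrightarrow> (\<forall>j\<in>B. w \<bullet> edge B j \<noteq> 0))"

definition faces :: "nat \<Rightarrow> 'v set set" where
  "faces k = {L. face L \<and> card L = k}"

text \<open>The h-vector of the complex of faces, read as the distribution of in-degrees in the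
  oriented dual graph.\<close>

definition h :: "'e \<Rightarrow> nat \<Rightarrow> nat" where
  "h w i = card {B. facet B \<and> card (inset w B) = i}"

lemma finite_faces: "finite (faces k)" and finite_facets: "finite {B. facet B}"
  by (rule finite_subset[of _ "Pow V"], auto simp: faces_def facet_def face_def finite_V)+

lemma ex_generic_objective: "\<exists>w. generic_objective w"
proof -
  define H where "H = (\<Union>B\<in>{B. facet B}. \<Union>j\<in>B. {w. edge B j \<bullet> w = 0})"
  have "negligible {w. edge B j \<bullet> w = 0}" if "facet B" "j \<in> B" for B j
    using edge(1)[OF that, of j] by (intro negligible_hyperplane) auto
  then have "negligible H"
    unfolding H_def using finite_facets facetD(2) by (intro negligible_Union) auto
  then have "H \<noteq> UNIV" using non_negligible_UNIV by metis
  then show ?thesis by (auto simp: H_def generic_objective_def inner_commute)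
qed

lemma generic_objective_uminus: "generic_objective w \<Longrightarrow> generic_objective (- w)"
  by (simp add: generic_objective_def)

lemma inset_subset: "inset w B \<subseteq> B"
  by (auto simp: inset_def)

lemma finite_inset: "facet B \<Longrightarrow> finite (inset w B)"
  using inset_subset facetD(2) finite_subset by blast

lemma card_inset_le: "facet B \<Longrightarrow> card (inset w B) \<le> m"
  using inset_subset facetD(2,3) card_mono by metis

lemma inset_uminus: "generic_objective w \<Longrightarrow> facet B \<Longrightarrow> inset (- w) B = B - inset w B"
  by (force simp: generic_objective_def inset_def)

lemma card_inset_uminus:
  assumes "generic_objective w" "facet B"
  shows "card (inset (- w) B) = m - card (inset w B)"
  using inset_uminus[OF assms] facetD[OF assms(2)] finite_inset[OF assms(2)] inset_subset
  by (simp add: card_Diff_subset)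

text \<open>Negating the objective exchanges the incoming and outgoing edges, and every vertex has
  \<open>m\<close> edges in total.\<close>

lemma h_uminus:
  assumes "generic_objective w" "i \<le> m"
  shows "h (- w) i = h w (m - i)"
proof -
  have "card (inset (- w) B) = i \<longleftrightarrow> card (inset w B) = m - i" if "facet B" for B
    using card_inset_uminus[OF assms(1) that] card_inset_le[OF that, of w] assms(2) by linarith
  then show ?thesis unfolding h_def by (metis (no_types, lifting))
qed

text \<open>In the expansion of \<open>w \<bullet> vertex B'\<close> by \<open>decomp\<close> at
  \<open>B\<close>, the terms of \<open>inset w B\<close> vanish, the others are nonnegative, and an
  index in \<open>B - B'\<close> contributes a positive term. This is the skewness for the set pair
  inequality.\<close>

lemma objective_less:
  assumes w: "generic_objective w" and B: "facet B" and B': "facet B'" and "B \<noteq> B'"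
    and sub: "inset w B \<subseteq> B'"
  shows "w \<bullet> vertex B < w \<bullet> vertex B'"
proof -
  have "\<not> B \<subseteq> B'" using facetD[OF B] facetD[OF B'] \<open>B \<noteq> B'\<close> card_subset_eq by metis
  then obtain i where i: "i \<in> B" "i \<notin> B'" by auto
  have nonneg: "(w \<bullet> edge B l) * (u l \<bullet> vertex B') \<ge> 0" if "l \<in> B" for l
  proof (cases "l \<in> inset w B")
    case True
    then show ?thesis using sub vertex(1)[OF B'] by auto
  next
    case False
    then show ?thesis using that vertex(3)[OF B', of l] facetD(1)[OF B]
      by (auto simp: inset_def not_less)
  qed
  have "w \<bullet> edge B i \<noteq> 0" using w B i by (auto simp: generic_objective_def)
  moreover have "\<not> w \<bullet> edge B i < 0" using i sub by (auto simp: inset_def)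
  moreover have "u i \<bullet> vertex B' > 0" using i facetD(1)[OF B] by (intro vertex(2)[OF B']) auto
  ultimately have "(w \<bullet> edge B i) * (u i \<bullet> vertex B') > 0" by simp
  then have "(\<Sum>l\<in>B. (w \<bullet> edge B l) * (u l \<bullet> vertex B')) > 0"
    using nonneg i(1) facetD(2)[OF B] by (intro sum_pos2) auto
  then show ?thesis using decomp[OF B, of w "vertex B'"] vertex(4)[OF B'] by simp
qed

text \<open>Existence: at a facet minimising \<open>w\<close> among those containing
  \<open>L\<close>, an incoming edge outside \<open>L\<close> would allow a pivot to a smaller
  value. Uniqueness: of two such facets, each would have a smaller value than the other by
  \<open>objective_less\<close>.\<close>

lemma ex1_minimal_facet:
  assumes w: "generic_objective w" and L: "face L" "card L \<le> m"
  shows "\<exists>!B. facet B \<and> L \<subseteq> B \<and> inset w B \<subseteq> L"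
proof -
  define S where "S = {B. facet B \<and> L \<subseteq> B}"
  have "finite S" using finite_facets by (rule rev_finite_subset) (auto simp: S_def)
  moreover have "S \<noteq> {}" using face_extend[OF L] by (auto simp: S_def)
  ultimately obtain B where "B \<in> S" and min: "\<And>B'. B' \<in> S \<Longrightarrow> w \<bullet> vertex B \<le> w \<bullet> vertex B'"
    using arg_min_if_finite(1)[of S "\<lambda>B. w \<bullet> vertex B"] arg_min_least[of S _ "\<lambda>B. w \<bullet> vertex B"]
    by blast
  then have B: "facet B" "L \<subseteq> B" by (auto simp: S_def)
  have "inset w B \<subseteq> L"
  proof (rule ccontr)
    assume "\<not> inset w B \<subseteq> L"
    then obtain j where j: "j \<in> B" "w \<bullet> edge B j < 0" "j \<notin> L" by (auto simp: inset_def)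
    obtain t i where "t > 0" "facet (insert i (B - {j}))"
      and v: "vertex (insert i (B - {j})) = vertex B + t *\<^sub>R edge B j"
      using facet_pivot[OF B(1) j(1)] by auto
    then have "insert i (B - {j}) \<in> S" using B j by (auto simp: S_def)
    from min[OF this] have "t * (w \<bullet> edge B j) \<ge> 0" by (simp add: v inner_add_right)
    then show False using \<open>t > 0\<close> j(2) by (simp add: zero_le_mult_iff)
  qed
  moreover have "B' = B" if B': "facet B'" "L \<subseteq> B'" "inset w B' \<subseteq> L" for B'
  proof (rule ccontr)
    assume "B' \<noteq> B"
    with objective_less[OF w B(1) B'(1)] objective_less[OF w B'(1) B(1)] B B' \<open>inset w B \<subseteq> L\<close>
    show False by fastforce
  qed
  ultimately show ?thesis using B by blast
qed

text \<open>Each face is counted at its unique minimal facet \<open>B\<close>, where it lies between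
  \<open>inset w B\<close> and \<open>B\<close>. Counting complements in \<open>B\<close> gives the
  lower index \<open>m - k\<close>, so the terms with \<open>i > k\<close> vanish.\<close>

lemma card_faces:
  assumes w: "generic_objective w" and k: "k \<le> m"
  shows "card (faces k) = (\<Sum>i\<le>m. h w i * ((m - i) choose (m - k)))"
proof -
  define I where "I B = {L. inset w B \<subseteq> L \<and> L \<subseteq> B \<and> card L = k}" for B
  have cardI: "card (I B) = (m - card (inset w B)) choose (m - k)" if B: "facet B" for B
  proof -
    have "bij_betw (\<lambda>L. B - L) (I B) {X. X \<subseteq> B - inset w B \<and> card X = m - k}"
    proof (rule bij_betwI[where g = "\<lambda>X. B - X"])
      show "(\<lambda>L. B - L) \<in> I B \<rightarrow> {X. X \<subseteq> B - inset w B \<and> card X = m - k}"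
        using facetD[OF B] by (auto simp: I_def card_Diff_subset finite_subset)
      show "(\<lambda>X. B - X) \<in> {X. X \<subseteq> B - inset w B \<and> card X = m - k} \<rightarrow> I B"
        using facetD[OF B] inset_subset[of w B] k
        by (auto simp: I_def card_Diff_subset finite_subset[of _ B] subset_Diff_insert)
          (subst card_Diff_subset; auto intro: finite_subset[of _ B])
    qed (use inset_subset in \<open>auto simp: I_def\<close>)
    then have "card (I B) = card {X. X \<subseteq> B - inset w B \<and> card X = m - k}"
      by (rule bij_betw_same_card)
    also have "\<dots> = card (B - inset w B) choose (m - k)"
      using facetD[OF B] by (intro n_subsets) auto
    finally show ?thesis
      using facetD[OF B] finite_inset[OF B] inset_subset[of w B] by (simp add: card_Diff_subset)
  qed
  have "faces k = (\<Union>B\<in>{B. facet B}. I B)"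
  proof
    show "faces k \<subseteq> (\<Union>B\<in>{B. facet B}. I B)"
      using ex1_minimal_facet[OF w] k by (fastforce simp: faces_def I_def)
    show "(\<Union>B\<in>{B. facet B}. I B) \<subseteq> faces k"
      using face_subset by (auto simp: faces_def I_def facet_def)
  qed
  moreover have "card (\<Union>B\<in>{B. facet B}. I B) = (\<Sum>B | facet B. card (I B))"
  proof (rule card_UN_disjoint[OF finite_facets])
    show "\<forall>B\<in>{B. facet B}. finite (I B)"
      using facetD(2) by (auto simp: I_def intro: finite_subset[of _ "Pow _"])
    show "\<forall>B\<in>{B. facet B}. \<forall>B'\<in>{B. facet B}. B \<noteq> B' \<longrightarrow> I B \<inter> I B' = {}"
    proof (intro ballI impI, rule ccontr)
      fix B B' assume B: "B \<in> {B. facet B}" "B' \<in> {B. facet B}" "B \<noteq> B'" "I B \<inter> I B' \<noteq> {}"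
      then obtain L where L: "L \<in> I B" "L \<in> I B'" by auto
      then have "face L" "card L \<le> m" using B face_subset k by (auto simp: I_def facet_def)
      from ex1_minimal_facet[OF w this] L B show False by (auto simp: I_def)
    qed
  qed
  ultimately have "card (faces k) = (\<Sum>B | facet B. (m - card (inset w B)) choose (m - k))"
    using cardI by simp
  also have "\<dots> = (\<Sum>i\<le>m. \<Sum>B\<in>{B\<in>{B. facet B}. card (inset w B) = i}.
      (m - card (inset w B)) choose (m - k))"
    using finite_facets card_inset_le by (intro sum.group[symmetric]) auto
  also have "\<dots> = (\<Sum>i\<le>m. h w i * ((m - i) choose (m - k)))"
    by (intro sum.cong refl) (simp add: h_def)
  finally show ?thesis .
qed

text \<open>The skew set pair inequality for \<open>inset w B\<close> and \<open>V - B\<close>: that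
  \<open>inset w B'\<close> misses \<open>V - B\<close> means
  \<open>inset w B' \<subseteq> B\<close>, and the objective increases by
  \<open>objective_less\<close>.\<close>

lemma sum_h_le:
  assumes w: "generic_objective w"
  shows "(\<Sum>j\<le>i. h w j) \<le> (card V - m + i) choose i"
proof -
  define F where "F = {B. facet B \<and> card (inset w B) \<le> i}"
  have "finite F" using finite_facets by (rule rev_finite_subset) (auto simp: F_def)
  have "card F = (\<Sum>B\<in>F. 1)" by simp
  also have "\<dots> = (\<Sum>j\<le>i. \<Sum>B\<in>{B\<in>F. card (inset w B) = j}. 1)"
    using \<open>finite F\<close> by (intro sum.group[symmetric]) (auto simp: F_def)
  also have "\<dots> = (\<Sum>j\<le>i. h w j)"
    by (intro sum.cong refl) (auto simp: h_def F_def intro!: arg_cong[where f = card])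
  finally have "(\<Sum>j\<le>i. h w j) = card F" by simp
  also have "card F \<le> (card V - m + i) choose i"
  proof (rule skew_set_pairs_bound[where R = "inset w" and C = "\<lambda>B. V - B" and \<mu> = "\<lambda>B. w \<bullet> vertex B"])
    fix B assume "B \<in> F"
    then have B: "facet B" "card (inset w B) \<le> i" by (auto simp: F_def)
    then show "finite (inset w B)" "finite (V - B)" "card (inset w B) \<le> i" "inset w B \<inter> (V - B) = {}"
      using finite_V finite_inset by (auto simp: inset_def)
    show "card (V - B) = card V - m"
      using facetD[OF B(1)] by (simp add: card_Diff_subset)
    fix B' assume "B' \<in> F" "B \<noteq> B'" "inset w B' \<inter> (V - B) = {}"
    then show "w \<bullet> vertex B' < w \<bullet> vertex B"
      using B facetD(1)[of B'] inset_subset[of w B']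
      by (intro objective_less[OF w]) (auto simp: F_def)
  qed (rule \<open>finite F\<close>)
  finally show ?thesis .
qed

text \<open>The face numbers \<open>card V choose j\<close> determine the h-numbers recursively,
  since \<open>h w j\<close> enters the count of \<open>j\<close>-faces with coefficient 1; the
  binomial convolution shows that the claimed values solve the same recursion.\<close>

lemma neighborly_h:
  assumes w: "generic_objective w"
    and neighborly: "\<And>L. L \<subseteq> V \<Longrightarrow> card L \<le> q \<Longrightarrow> face L" and q: "q \<le> m" and j: "j \<le> q"
  shows "h w j = (card V - m - 1 + j) choose j"
  using j
proof (induction j rule: less_induct)
  case (less j)
  define g where "g i = (card V - m - 1 + i) choose i" for i
  have jm: "j \<le> m" using less.prems q by simp
  have sum_eq: "(\<Sum>i\<le>j. f i * ((m - i) choose (j - i))) =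
      f j + (\<Sum>i<j. f i * ((m - i) choose (j - i)))" for f :: "nat \<Rightarrow> nat"
    by (simp add: lessThan_Suc_atMost[symmetric])
  have "faces j = {L. L \<subseteq> V \<and> card L = j}"
    using neighborly less.prems by (auto simp: faces_def face_def)
  then have "card (faces j) = card V choose j" using n_subsets[OF finite_V] by simp
  moreover have "card (faces j) = (\<Sum>i\<le>j. h w i * ((m - i) choose (j - i)))"
  proof -
    have "card (faces j) = (\<Sum>i\<le>j. h w i * ((m - i) choose (m - j)))"
      unfolding card_faces[OF w jm] using jm
      by (intro sum.mono_neutral_right) (auto simp: binomial_eq_0)
    also have "\<dots> = (\<Sum>i\<le>j. h w i * ((m - i) choose (j - i)))"
      using jm by (intro sum.cong refl) (simp add: binomial_symmetric[of "m - j" "m - _"])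
    finally show ?thesis .
  qed
  moreover have "(\<Sum>i\<le>j. g i * ((m - i) choose (j - i))) = card V choose j"
    unfolding g_def using sum_binomial_convolution[OF jm, of "card V - m - 1"] card_V by simp
  moreover have "(\<Sum>i<j. h w i * ((m - i) choose (j - i))) = (\<Sum>i<j. g i * ((m - i) choose (j - i)))"
    using less by (intro sum.cong refl) (auto simp: g_def)
  ultimately have "h w j = g j" unfolding sum_eq by simp
  then show ?case by (simp add: g_def)
qed

text \<open>Adds the counts for \<open>w\<close> and \<open>- w\<close>. The weight \<psi> is
  invariant under \<open>i \<mapsto> m - i\<close>, so the upper half of \<open>h w\<close> folds
  into the lower half of \<open>h (- w)\<close>, and only indices up to \<open>m div 2\<close>
  remain.\<close>

lemma two_card_faces:
  assumes w: "generic_objective w" and k: "k \<le> m"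
  defines "\<psi> \<equiv> \<lambda>i. real ((m - i) choose (m - k)) + real (i choose (m - k))"
  shows "2 * real (card (faces k)) =
    (\<Sum>i\<le>m div 2. real (h w i) * \<psi> i) + (\<Sum>i<m - m div 2. real (h (- w) i) * \<psi> i)"
proof -
  have "card (faces k) = (\<Sum>i\<le>m. h (- w) i * ((m - i) choose (m - k)))"
    by (rule card_faces[OF generic_objective_uminus[OF w] k])
  also have "\<dots> = (\<Sum>i\<le>m. h w (m - i) * ((m - i) choose (m - k)))"
    using h_uminus[OF w] by (intro sum.cong) auto
  also have "\<dots> = (\<Sum>i\<le>m. h w i * (i choose (m - k)))"
    by (rule sum.reindex_bij_witness[of _ "\<lambda>i. m - i" "\<lambda>i. m - i"]) auto
  finally have "2 * card (faces k) =
      (\<Sum>i\<le>m. h w i * ((m - i) choose (m - k))) + (\<Sum>i\<le>m. h w i * (i choose (m - k)))"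
    using card_faces[OF w k] by linarith
  then have "real (2 * card (faces k)) = real \<dots>" by (rule arg_cong)
  then have "2 * real (card (faces k)) = (\<Sum>i\<le>m. real (h w i) * \<psi> i)"
    by (simp add: \<psi>_def sum.distrib distrib_left)
  also have "{..m} = {..m div 2} \<union> {Suc (m div 2)..m}" by auto
  also have "(\<Sum>i\<in>{..m div 2} \<union> {Suc (m div 2)..m}. real (h w i) * \<psi> i) =
      (\<Sum>i\<le>m div 2. real (h w i) * \<psi> i) + (\<Sum>i=Suc (m div 2)..m. real (h w i) * \<psi> i)"
    by (intro sum.union_disjoint) auto
  also have "(\<Sum>i=Suc (m div 2)..m. real (h w i) * \<psi> i) = (\<Sum>i<m - m div 2. real (h (- w) i) * \<psi> i)"
    by (rule sum.reindex_bij_witness[of _ "\<lambda>i. m - i" "\<lambda>i. m - i"])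
      (auto simp: h_uminus[OF w] \<psi>_def add.commute)
  finally show ?thesis .
qed

section \<open>A lower bound for the faces through a given face\<close>

text \<open>The bound is attained by the boundary of a simplex. Faces inside one facet
  \<open>B\<close> above \<open>S\<close> and faces through \<open>S\<close> and a pivot vertex
  \<open>j\<close> outside \<open>B\<close> are disjoint families, and their counts add up by
  Pascal's rule.\<close>

lemma card_faces_containing:
  assumes S: "face S" "card S \<le> k" and k: "k \<le> m"
  shows "(Suc m - card S) choose (k - card S) \<le> card {L\<in>faces k. S \<subseteq> L}"
  using S
proof (induction "m - card S" arbitrary: S rule: less_induct)
  case less
  have finS: "finite S" using less.prems finite_V finite_subset by (auto simp: face_def)
  have fin: "finite {L\<in>faces k. P L}" for P using finite_faces by simp
  show ?case
  proof (cases "card S = k")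
    case True
    then have "S \<in> {L\<in>faces k. S \<subseteq> L}" using less.prems by (auto simp: faces_def)
    then have "card {L\<in>faces k. S \<subseteq> L} > 0" using fin card_gt_0_iff by blast
    then show ?thesis using True by simp
  next
    case False
    then have lt: "card S < k" using less.prems by simp
    obtain B where B: "facet B" "S \<subseteq> B" using face_extend[OF less.prems(1)] lt k by auto
    have "S \<noteq> B" using facetD(3)[OF B(1)] lt k by auto
    then obtain i where i: "i \<in> B" "i \<notin> S" using B by auto
    from facet_pivot[OF B(1) i(1)] obtain j where j: "j \<in> V - B" "facet (insert j (B - {i}))" by auto
    have "insert j S \<subseteq> insert j (B - {i})" "j \<notin> S" using j B i by auto
    then have Sj: "face (insert j S)" "card (insert j S) = Suc (card S)"
      using face_subset[of "insert j (B - {i})" "insert j S"] j(2) finS by (simp_all add: facet_def)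
    define \<L>1 where "\<L>1 = {L. S \<subseteq> L \<and> L \<subseteq> B \<and> card L = k}"
    define \<L>2 where "\<L>2 = {L\<in>faces k. insert j S \<subseteq> L}"
    have "bij_betw (\<lambda>X. S \<union> X) {X. X \<subseteq> B - S \<and> card X = k - card S} \<L>1"
    proof (rule bij_betwI[where g = "\<lambda>L. L - S"])
      show "(\<lambda>X. S \<union> X) \<in> {X. X \<subseteq> B - S \<and> card X = k - card S} \<rightarrow> \<L>1"
        using facetD(2)[OF B(1)] finS B(2) lt
        by (auto simp: \<L>1_def card_Un_disjoint finite_subset[of _ "B - S"] intro!: trans[OF card_Un_disjoint])
      show "(\<lambda>L. L - S) \<in> \<L>1 \<rightarrow> {X. X \<subseteq> B - S \<and> card X = k - card S}"
        using finS by (auto simp: \<L>1_def card_Diff_subset)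
    qed (auto simp: \<L>1_def)
    then have "card \<L>1 = card {X. X \<subseteq> B - S \<and> card X = k - card S}"
      by (metis bij_betw_same_card)
    also have "\<dots> = card (B - S) choose (k - card S)"
      using facetD[OF B(1)] by (intro n_subsets) auto
    finally have c1: "card \<L>1 = (m - card S) choose (k - card S)"
      using facetD[OF B(1)] finS B(2) by (simp add: card_Diff_subset)
    have c2: "(m - card S) choose (k - Suc (card S)) \<le> card \<L>2"
      unfolding \<L>2_def using less.hyps[of "insert j S"] Sj lt k by auto
    have "\<L>1 \<inter> \<L>2 = {}" using j by (auto simp: \<L>1_def \<L>2_def)
    moreover have "finite \<L>1" using facetD(2)[OF B(1)]
      by (intro finite_subset[of \<L>1 "Pow B"]) (auto simp: \<L>1_def)
    moreover have "finite \<L>2" unfolding \<L>2_def by (rule fin)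
    ultimately have "card \<L>1 + card \<L>2 = card (\<L>1 \<union> \<L>2)" by (simp add: card_Un_disjoint)
    also have "\<dots> \<le> card {L\<in>faces k. S \<subseteq> L}"
      using face_subset[of B] B(1) by (intro card_mono fin) (auto simp: \<L>1_def \<L>2_def faces_def facet_def)
    finally have "card \<L>1 + card \<L>2 \<le> card {L\<in>faces k. S \<subseteq> L}" .
    moreover have "(Suc m - card S) choose (k - card S) =
        ((m - card S) choose (k - Suc (card S))) + ((m - card S) choose (k - card S))"
    proof -
      have "Suc m - card S = Suc (m - card S)" "k - card S = Suc (k - Suc (card S))" using lt k by auto
      then show ?thesis by simp
    qed
    ultimately show ?thesis using c1 c2 by simp
  qed
qed

end

section \<open>Comparison with a neighborly configuration\<close>

text \<open>On the neighborly side the partial sums of the h-numbers equal the bound of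
  \<open>sum_h_le\<close>. Summation by parts carries this domination to the two weighted half sums
  of \<open>two_card_faces\<close>.\<close>

theorem upper_bound:
  fixes V :: "'v set" and V' :: "'w set" and u :: "'v \<Rightarrow> 'e::euclidean_space"
    and u' :: "'w \<Rightarrow> 'f::euclidean_space"
  assumes "vector_config V u m" and "vector_config V' u' m" and card: "card V' = card V"
    and neighborly: "\<And>L. L \<subseteq> V' \<Longrightarrow> card L \<le> m div 2 \<Longrightarrow> vector_config.face V' u' L"
    and k: "k \<le> m"
  shows "card (vector_config.faces V u k) \<le> card (vector_config.faces V' u' k)"
proof -
  interpret X: vector_config V u m by fact
  interpret Y: vector_config V' u' m by fact
  obtain w where w: "X.generic_objective w" using X.ex_generic_objective by auto
  obtain v where v: "Y.generic_objective v" using Y.ex_generic_objective by auto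
  define a where "a = card V - m - 1"
  have V: "card V - m = Suc a" "card V - m - 1 = a" using X.card_V by (auto simp: a_def)
  define \<psi> where "\<psi> i = real ((m - i) choose (m - k)) + real (i choose (m - k))" for i
  \<comment> \<open>With \<open>m - k = Suc r\<close>, Pascal's rule turns
    \<open>\<psi> i - \<psi> (Suc i)\<close> into
    \<open>((m - Suc i) choose r) - (i choose r)\<close>, which is nonnegative because
    \<open>i \<le> m - Suc i\<close> in the lower half.\<close>
  have anti: "\<psi> (Suc i) \<le> \<psi> i" if "i < m div 2" for i
  proof (cases "m - k")
    case (Suc r)
    have "m - i = Suc (m - Suc i)" using that by auto
    then have "((m - i) choose (m - k)) = ((m - Suc i) choose r) + ((m - Suc i) choose (m - k))"
      by (simp add: Suc)
    moreover have "(Suc i choose (m - k)) = (i choose r) + (i choose (m - k))" by (simp add: Suc)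
    moreover have "(i choose r) \<le> ((m - Suc i) choose r)" using that by (intro binomial_right_mono) auto
    ultimately show ?thesis by (simp add: \<psi>_def)
  qed (simp add: \<psi>_def)
  have compare: "(\<Sum>i\<le>q. real (X.h x i) * \<psi> i) \<le> (\<Sum>i\<le>q. real (Y.h y i) * \<psi> i)"
    if x: "X.generic_objective x" and y: "Y.generic_objective y" and q: "q \<le> m div 2" for x y q
  proof (rule sum_mult_antimono_le)
    fix j assume "j \<le> q"
    have "(\<Sum>i\<le>j. X.h x i) \<le> (Suc a + j) choose j"
      using X.sum_h_le[OF x, of j] V by simp
    also have "\<dots> = (\<Sum>i\<le>j. (a + i) choose i)" by (simp add: sum_choose_lower)
    also have "\<dots> = (\<Sum>i\<le>j. Y.h y i)"
    proof (intro sum.cong refl)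
      fix i assume "i \<in> {..j}"
      then show "(a + i choose i) = Y.h y i"
        using Y.neighborly_h[OF y neighborly, of "m div 2" i] \<open>j \<le> q\<close> q V card by simp
    qed
    finally show "(\<Sum>i\<le>j. real (X.h x i)) \<le> (\<Sum>i\<le>j. real (Y.h y i))"
      by (simp only: of_nat_sum[symmetric] of_nat_le_iff)
  qed (use anti q in \<open>auto simp: \<psi>_def\<close>)
  have split: "(\<Sum>i<m - m div 2. real (X.h (- w) i) * \<psi> i) \<le> (\<Sum>i<m - m div 2. real (Y.h (- v) i) * \<psi> i)"
  proof (cases "m - m div 2")
    case (Suc q)
    \<comment> \<open>The last index of the second half sum is \<open>m div 2\<close> for odd
      \<open>m\<close> and one less for even \<open>m\<close>.\<close>
    have "q \<le> m div 2" using Suc by linarith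
    from compare[OF X.generic_objective_uminus[OF w] Y.generic_objective_uminus[OF v] this]
    show ?thesis by (simp add: Suc lessThan_Suc_atMost)
  next
    case 0
    show ?thesis unfolding 0 by simp
  qed
  have "2 * real (card (X.faces k)) \<le> 2 * real (card (Y.faces k))"
    unfolding X.two_card_faces[OF w k] Y.two_card_faces[OF v k] \<psi>_def[symmetric]
    using compare[OF w v order_refl] split by (rule add_mono)
  then show ?thesis by simp
qed

section \<open>Loadouts as faces\<close>

text \<open>The vectors are chosen one by one, avoiding the finitely many proper subspaces spanned
  by fewer than \<open>DIM('e)\<close> earlier ones. The vector at \<open>v0\<close> stays exact
  because it will be the constraint at infinity.\<close>

lemma generic_perturbation:
  fixes b :: "'v \<Rightarrow> 'e::euclidean_space"
  assumes "finite V" "v0 \<notin> V" "b0 \<noteq> 0" "\<epsilon> > 0"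
  shows "\<exists>u. u v0 = b0 \<and> (\<forall>j\<in>V. norm (u j - b j) < \<epsilon>) \<and>
    (\<forall>S\<subseteq>insert v0 V. card S \<le> DIM('e) \<longrightarrow> inj_on u S \<and> independent (u ` S))"
  using assms(1,2)
proof (induction V rule: finite_induct)
  case empty
  have "inj_on (\<lambda>_. b0) S \<and> independent ((\<lambda>_. b0) ` S)" if "S \<subseteq> {v0}" for S
  proof -
    have "S = {} \<or> S = {v0}" using that by blast
    then show ?thesis using assms(3) by (auto simp: independent_empty)
  qed
  then show ?case by (intro exI[of _ "\<lambda>_. b0"]) auto
next
  case (insert x V)
  then obtain u where u: "u v0 = b0" "\<And>j. j \<in> V \<Longrightarrow> norm (u j - b j) < \<epsilon>"
    and indep: "\<And>S. S \<subseteq> insert v0 V \<Longrightarrow> card S \<le> DIM('e) \<Longrightarrow> inj_on u S \<and> independent (u ` S)"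
    by auto
  define N where "N = (\<Union>S\<in>{S. S \<subseteq> insert v0 V \<and> card S < DIM('e)}. span (u ` S))"
  have "negligible N" unfolding N_def
  proof (rule negligible_Union)
    show "finite ((\<lambda>S. span (u ` S)) ` {S. S \<subseteq> insert v0 V \<and> card S < DIM('e)})"
      using insert.hyps by auto
    fix T assume "T \<in> (\<lambda>S. span (u ` S)) ` {S. S \<subseteq> insert v0 V \<and> card S < DIM('e)}"
    then obtain S where S: "S \<subseteq> insert v0 V" "card S < DIM('e)" "T = span (u ` S)" by auto
    have "finite S" using S insert.hyps finite_subset by blast
    have "dim T \<le> card (u ` S)" unfolding S(3) dim_span using \<open>finite S\<close> by (intro dim_le_card') auto
    also have "\<dots> < DIM('e)" using S card_image_le[OF \<open>finite S\<close>, of u] by simp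
    finally show "negligible T" by (rule negligible_lowdim)
  qed
  moreover have "\<not> negligible (ball (b x) \<epsilon>)" using assms(4) by (intro open_not_negligible) auto
  ultimately have "\<not> ball (b x) \<epsilon> \<subseteq> N" using negligible_subset by blast
  then obtain a where "a \<in> ball (b x) \<epsilon>" "a \<notin> N" by blast
  then have a: "norm (a - b x) < \<epsilon>" "a \<notin> N" by (simp_all add: dist_norm norm_minus_commute)
  define u' where "u' = u(x := a)"
  have indep': "inj_on u' S \<and> independent (u' ` S)"
    if S: "S \<subseteq> insert v0 (insert x V)" "card S \<le> DIM('e)" for S
  proof (cases "x \<in> S")
    case False
    then have "u' ` S = u ` S" "inj_on u' S \<longleftrightarrow> inj_on u S" by (auto simp: u'_def inj_on_def)
    then show ?thesis using indep[of S] S False by auto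
  next
    case True
    define S0 where "S0 = S - {x}"
    have "finite S" using S insert.hyps finite_subset by blast
    then have "card S0 < card S" unfolding S0_def using True by (intro card_Diff1_less)
    then have S0: "S0 \<subseteq> insert v0 V" "card S0 < DIM('e)" "S = insert x S0" "x \<notin> S0"
      using S True by (auto simp: S0_def)
    have eq: "u' ` S0 = u ` S0" "inj_on u' S0 \<longleftrightarrow> inj_on u S0"
      using S0(4) by (auto simp: u'_def inj_on_def)
    have ind: "inj_on u S0" "independent (u ` S0)" using indep[of S0] S0 by auto
    have "a \<notin> span (u ` S0)" using a(2) S0(1,2) unfolding N_def by blast
    then have "a \<notin> u ` S0" using span_base[of a "u ` S0"] by metis
    show ?thesis
    proof -
      have "u' ` S = insert a (u ` S0)" unfolding S0(3) image_insert eq(1) by (simp add: u'_def)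
      moreover have "u' x \<notin> u' ` S0" unfolding eq(1) using \<open>a \<notin> u ` S0\<close> by (simp add: u'_def)
      then have "inj_on u' S" unfolding S0(3) inj_on_insert using eq(2) ind(1) S0(4) by simp
      ultimately show ?thesis
        using ind(2) \<open>a \<notin> span (u ` S0)\<close> \<open>a \<notin> u ` S0\<close> by (simp add: independent_insert)
    qed
  qed
  have "u' v0 = b0" using u(1) insert.prems by (simp add: u'_def)
  moreover have "\<forall>j\<in>insert x V. norm (u' j - b j) < \<epsilon>"
  proof
    fix j assume "j \<in> insert x V"
    then show "norm (u' j - b j) < \<epsilon>" using u(2)[of j] a(1) by (cases "j = x") (simp_all add: u'_def)
  qed
  moreover have "\<forall>S\<subseteq>insert v0 (insert x V). card S \<le> DIM('e) \<longrightarrow> inj_on u' S \<and> independent (u' ` S)"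
    by (intro allI impI indep')
  ultimately show ?case by (intro exI[of _ u'] conjI)
qed

lemma orthogonal_to_full_independent_family:
  fixes u :: "'v \<Rightarrow> 'e::euclidean_space"
  assumes S: "inj_on u S" "independent (u ` S)" "card S = DIM('e)"
    and z: "\<And>j. j \<in> S \<Longrightarrow> u j \<bullet> z = 0"
  shows "z = 0"
proof -
  have "dim (u ` S) = DIM('e)" using S by (simp add: dim_eq_card_independent card_image)
  then have "z \<in> span (u ` S)" by (simp add: dim_eq_full)
  moreover have "orthogonal z y" if "y \<in> u ` S" for y
    using that z by (auto simp: orthogonal_def inner_commute)
  ultimately have "orthogonal z z" using orthogonal_to_span by blast
  then show ?thesis by (simp add: orthogonal_def)
qed

section \<open>Uniqueness of the optimum and its stability\<close>

text \<open>For small \<open>t > 0\<close> the point \<open>x + t *\<^sub>R d\<close> is again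
  optimal: coordinates in \<open>L\<close> have room to decrease, and the others do not decrease.
  Uniqueness of the optimum gives \<open>d = 0\<close>.\<close>

lemma loadout_no_direction:
  fixes A :: "real ^ 'n ^ 'm"
  assumes "loadout A c L" and d: "\<And>j. j \<notin> L \<Longrightarrow> d $ j \<ge> 0" "A *v d \<le> 0" "c \<bullet> d \<ge> 0"
  shows "d = 0"
proof -
  obtain b x where x: "lp_optimal A c b = {x}" "supp x = L"
    using assms(1) by (auto simp: loadout_def)
  then have "x \<in> lp_optimal A c b" by simp
  then have feas: "A *v x \<le> b" "0 \<le> x" and opt: "\<And>y. y \<in> lp_feasible A b \<Longrightarrow> c \<bullet> y \<le> c \<bullet> x"
    by (auto simp: lp_optimal_def lp_feasible_def)
  have "\<forall>j\<in>UNIV. \<forall>\<^sub>F t in at_right 0. (x + t *\<^sub>R d) $ j \<ge> 0"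
  proof
    fix j
    show "\<forall>\<^sub>F t in at_right 0. (x + t *\<^sub>R d) $ j \<ge> 0"
    proof (cases "j \<in> L")
      case True
      have "((\<lambda>t. (x + t *\<^sub>R d) $ j) \<longlongrightarrow> (x + 0 *\<^sub>R d) $ j) (at_right 0)"
        by (intro tendsto_intros)
      moreover have "x $ j > 0" using True x(2) by (auto simp: supp_def)
      ultimately have "\<forall>\<^sub>F t in at_right 0. (x + t *\<^sub>R d) $ j > 0"
        by (intro order_tendstoD) auto
      then show ?thesis by eventually_elim simp
    next
      case False
      have "\<forall>\<^sub>F t in at_right (0::real). t > 0" by (rule eventually_at_right_less)
      then show ?thesis
        by eventually_elim (use d(1)[OF False] feas(2) in \<open>simp add: less_eq_vec_def\<close>)
    qed
  qed
  then have "\<forall>\<^sub>F t in at_right 0. \<forall>j\<in>UNIV. (x + t *\<^sub>R d) $ j \<ge> 0"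
    by (intro eventually_ball_finite) auto
  with eventually_at_right_less[of "0::real"]
  have "\<forall>\<^sub>F t in at_right 0. t > 0 \<and> (\<forall>j\<in>UNIV. (x + t *\<^sub>R d) $ j \<ge> 0)"
    by (rule eventually_conj)
  from eventually_happens'[OF _ this] obtain t where
    t: "t > 0" "\<And>j. (x + t *\<^sub>R d) $ j \<ge> 0" by auto
  have "A *v (x + t *\<^sub>R d) = A *v x + t *\<^sub>R (A *v d)"
    by (simp add: matrix_vector_right_distrib matrix_vector_mult_scaleR)
  also have "\<dots> \<le> b + 0"
  proof (rule add_mono)
    show "t *\<^sub>R (A *v d) \<le> 0"
      using d(2) t(1) by (simp add: less_eq_vec_def mult_nonneg_nonpos)
  qed (rule feas)
  finally have "x + t *\<^sub>R d \<in> lp_feasible A b"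
    using t(2) by (simp add: lp_feasible_def less_eq_vec_def)
  moreover have "c \<bullet> (x + t *\<^sub>R d) \<ge> c \<bullet> x" using d(3) t(1) by (simp add: inner_add_right)
  ultimately have "x + t *\<^sub>R d \<in> lp_optimal A c b"
    unfolding lp_optimal_def using opt order_trans by blast
  then show ?thesis using x(1) t(1) by simp
qed

text \<open>The pair \<open>(A *v d, - (c \<bullet> d))\<close> lies here exactly when
  \<open>d\<close> increases no constraint and does not lower the objective.\<close>

definition nonpos_orthant :: "((real ^ 'm) \<times> real) set" where
  "nonpos_orthant = {y. (\<forall>i. fst y $ i \<le> 0) \<and> snd y \<le> 0}"

lemma closed_nonpos_orthant: "closed nonpos_orthant"
proof -
  have "nonpos_orthant = (\<Inter>i. {y :: (real ^ 'a) \<times> real. fst y $ i \<le> 0}) \<inter> {y. snd y \<le> 0}"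
    by (auto simp: nonpos_orthant_def)
  also have "closed \<dots>"
    by (intro closed_Int closed_INT ballI closed_Collect_le continuous_intros)
  finally show ?thesis .
qed

text \<open>The homogenised columns of the dual linear program \<open>A\<^sup>T y \<ge> c\<close>: the sign conditions are
  those of \<open>column j A \<bullet> y - c $ j\<close>.\<close>

definition lift_column :: "real ^ 'n ^ 'm \<Rightarrow> real ^ 'n \<Rightarrow> 'n \<Rightarrow> (real ^ 'm) \<times> real" where
  "lift_column A c j = (column j A, - c $ j)"

text \<open>Compactness: the unit vectors \<open>d\<close> with the prescribed signs have a compact
  image under \<open>g\<close>, disjoint from the closed orthant, hence at positive distance from
  it.\<close>

lemma loadout_stable:
  fixes A :: "real ^ 'n ^ 'm"
  assumes "loadout A c L"
  shows "\<exists>\<delta>>0. \<forall>u. (\<forall>j. norm (u j - lift_column A c j) < \<delta>) \<longrightarrow>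
    (\<forall>d. d \<noteq> 0 \<longrightarrow> (\<forall>j. j \<notin> L \<longrightarrow> d $ j \<ge> 0) \<longrightarrow> (\<Sum>j\<in>UNIV. d $ j *\<^sub>R u j) \<notin> nonpos_orthant)"
proof -
  define D where "D = sphere 0 1 \<inter> (\<Inter>j\<in>- L. {d :: real ^ 'n. 0 \<le> d $ j})"
  define g where "g d = (\<Sum>j\<in>UNIV. d $ j *\<^sub>R lift_column A c j)" for d
  have "compact D" unfolding D_def
    by (intro compact_Int_closed closed_INT ballI closed_Collect_le continuous_intros) auto
  then have "compact (g ` D)"
    unfolding g_def by (intro compact_continuous_image continuous_intros)
  moreover have "g ` D \<inter> nonpos_orthant = {}"
  proof (rule ccontr)
    assume "g ` D \<inter> nonpos_orthant \<noteq> {}"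
    then obtain d where d: "d \<in> D" "g d \<in> nonpos_orthant" by auto
    have "fst (g d) = A *v d"
      by (simp add: g_def lift_column_def fst_sum matrix_mult_sum vector_scalar_mult_def vec_eq_iff)
    then have "A *v d \<le> 0" using d(2) by (simp add: nonpos_orthant_def less_eq_vec_def)
    moreover have "snd (g d) = - (c \<bullet> d)"
      by (simp add: g_def lift_column_def snd_sum inner_vec_def sum_negf mult.commute)
    then have "c \<bullet> d \<ge> 0" using d(2) by (simp add: nonpos_orthant_def)
    ultimately have "d = 0" using d(1) by (intro loadout_no_direction[OF assms]) (auto simp: D_def)
    then show False using d(1) by (simp add: D_def)
  qed
  ultimately obtain \<delta>0 where \<delta>0: "\<delta>0 > 0" "\<And>x y. x \<in> g ` D \<Longrightarrow> y \<in> nonpos_orthant \<Longrightarrow> \<delta>0 \<le> dist x y"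
    using separate_compact_closed[OF _ closed_nonpos_orthant] by metis
  \<comment> \<open>Each of the \<open>CARD('n)\<close> columns moves by less than \<delta>, with a
    coefficient of absolute value at most 1, so the image of a unit vector moves by less than
    \<delta>0.\<close>
  define \<delta> where "\<delta> = \<delta>0 / CARD('n)"
  show ?thesis
  proof (intro exI[of _ \<delta>] conjI allI impI notI)
    show "\<delta> > 0" using \<delta>0 by (simp add: \<delta>_def)
    fix u :: "'n \<Rightarrow> (real ^ 'm) \<times> real" and d :: "real ^ 'n"
    assume u: "\<forall>j. norm (u j - lift_column A c j) < \<delta>" and d: "d \<noteq> 0" "\<forall>j. j \<notin> L \<longrightarrow> d $ j \<ge> 0"
      and mem: "(\<Sum>j\<in>UNIV. d $ j *\<^sub>R u j) \<in> nonpos_orthant"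
    define e where "e = (1 / norm d) *\<^sub>R d"
    have e: "e \<in> D" using d by (auto simp: D_def e_def)
    have "(\<Sum>j\<in>UNIV. e $ j *\<^sub>R u j) = (1 / norm d) *\<^sub>R (\<Sum>j\<in>UNIV. d $ j *\<^sub>R u j)"
      by (simp add: e_def scaleR_sum_right)
    also have "\<dots> \<in> nonpos_orthant"
      using mem d(1) by (auto simp: nonpos_orthant_def intro: divide_nonpos_pos)
    finally have "\<delta>0 \<le> dist (g e) (\<Sum>j\<in>UNIV. e $ j *\<^sub>R u j)" using e \<delta>0(2) by blast
    also have "\<dots> = norm (\<Sum>j\<in>UNIV. e $ j *\<^sub>R (u j - lift_column A c j))"
      by (simp add: g_def dist_norm norm_minus_commute scaleR_diff_right sum_subtractf)
    also have "\<dots> \<le> (\<Sum>j\<in>UNIV. norm (e $ j *\<^sub>R (u j - lift_column A c j)))" by (rule norm_sum)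
    also have "\<dots> < (\<Sum>j\<in>(UNIV :: 'n set). \<delta>)"
    proof (rule sum_strict_mono)
      fix j
      have "\<bar>e $ j\<bar> \<le> 1" using component_le_norm_cart[of e j] e by (simp add: D_def)
      then have "norm (e $ j *\<^sub>R (u j - lift_column A c j)) \<le> norm (u j - lift_column A c j)"
        by (simp add: mult_left_le_one_le)
      then show "norm (e $ j *\<^sub>R (u j - lift_column A c j)) < \<delta>" using u by (meson le_less_trans)
    qed auto
    also have "\<dots> = \<delta>0" by (simp add: \<delta>_def)
    finally show False by simp
  qed
qed

section \<open>Strict complementarity and the configuration of a design\<close>

text \<open>A Farkas argument with strictness built into the target \<open>k0\<close>: were
  \<open>k0\<close> outside the convex cone \<open>K\<close>, a separating normal would be a
  direction that \<open>no_direction\<close> excludes.\<close>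

lemma dual_certificate:
  fixes u :: "'n::finite option \<Rightarrow> (real ^ 'm) \<times> real" and L :: "'n set"
  assumes None: "u None = (0, 1)"
    and no_direction: "\<And>d :: real ^ 'n. d \<noteq> 0 \<Longrightarrow> (\<forall>j. j \<notin> L \<longrightarrow> d $ j \<ge> 0) \<Longrightarrow>
      (\<Sum>j\<in>UNIV. d $ j *\<^sub>R u (Some j)) \<notin> nonpos_orthant"
  shows "\<exists>z. (\<forall>j\<in>Some ` L. u j \<bullet> z = 0) \<and> (\<forall>j\<in>UNIV - Some ` L. u j \<bullet> z > 0)"
proof -
  define f :: "real ^ 'n \<Rightarrow> real ^ 'm \<Rightarrow> real \<Rightarrow> real ^ 'n" where
    "f \<alpha> y \<beta> = (\<chi> j. (if j \<in> L then 0 else \<alpha> $ j) - u (Some j) \<bullet> (y, \<beta>))" for \<alpha> y \<beta>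
  define K where "K = {f \<alpha> y \<beta> |\<alpha> y \<beta>. 0 \<le> \<alpha> \<and> 0 \<le> y \<and> 0 \<le> \<beta>}"
  \<comment> \<open>The term \<open>snd (u (Some j))\<close> raises \<beta> by 1 and the other term
    raises \<alpha> by 1 outside \<open>L\<close>. So \<open>k0 \<in> K\<close> yields a point
    \<open>(y, \<beta> + 1)\<close> that is strict outside \<open>L\<close> and at
    \<open>None\<close>.\<close>
  define k0 :: "real ^ 'n" where "k0 = (\<chi> j. snd (u (Some j)) - (if j \<in> L then 0 else 1))"
  have f_add: "f \<alpha> y \<beta> + f \<alpha>' y' \<beta>' = f (\<alpha> + \<alpha>') (y + y') (\<beta> + \<beta>')"
    and f_scale: "s *\<^sub>R f \<alpha> y \<beta> = f (s *\<^sub>R \<alpha>) (s *\<^sub>R y) (s * \<beta>)" for \<alpha> y \<beta> \<alpha>' y' \<beta>' s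
    by (auto simp: f_def vec_eq_iff inner_prod_def inner_add_right algebra_simps)
  have K_scale: "s *\<^sub>R k \<in> K" if "k \<in> K" "s \<ge> 0" for k s
  proof -
    from that(1) obtain \<alpha> y \<beta> where k: "k = f \<alpha> y \<beta>" "0 \<le> \<alpha>" "0 \<le> y" "0 \<le> \<beta>"
      unfolding K_def by blast
    then have "s *\<^sub>R k = f (s *\<^sub>R \<alpha>) (s *\<^sub>R y) (s * \<beta>)"
      "0 \<le> s *\<^sub>R \<alpha>" "0 \<le> s *\<^sub>R y" "0 \<le> s * \<beta>"
      using that(2) f_scale by (auto simp: less_eq_vec_def)
    then show ?thesis unfolding K_def by blast
  qed
  have K_add: "k + k' \<in> K" if "k \<in> K" "k' \<in> K" for k k'
  proof -
    from that obtain \<alpha> y \<beta> \<alpha>' y' \<beta>' where k: "k = f \<alpha> y \<beta>" "0 \<le> \<alpha>" "0 \<le> y" "0 \<le> \<beta>"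
      and k': "k' = f \<alpha>' y' \<beta>'" "0 \<le> \<alpha>'" "0 \<le> y'" "0 \<le> \<beta>'" unfolding K_def by blast
    have "k + k' = f (\<alpha> + \<alpha>') (y + y') (\<beta> + \<beta>')" using k k' f_add by simp
    moreover have "0 \<le> \<alpha> + \<alpha>'" "0 \<le> y + y'" "0 \<le> \<beta> + \<beta>'"
      using k k' by (auto simp: less_eq_vec_def)
    ultimately show ?thesis unfolding K_def by blast
  qed
  have "k0 \<in> K"
  proof (rule ccontr)
    assume "k0 \<notin> K"
    \<comment> \<open>Weak separation suffices, since \<open>no_direction\<close> excludes every
      nonzero normal that is nonnegative on \<open>K\<close>.\<close>
    have "convex K" using K_scale K_add by (intro convexI) auto
    then have "convex ((\<lambda>k. - k0 + k) ` K)" by (rule convex_translation)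
    moreover have "0 \<notin> (\<lambda>k. - k0 + k) ` K"
    proof
      assume "0 \<in> (\<lambda>k. - k0 + k) ` K"
      then obtain k where "0 = - k0 + k" "k \<in> K" by (rule imageE)
      then show False using \<open>k0 \<notin> K\<close> by simp
    qed
    ultimately have "\<exists>d. d \<noteq> 0 \<and> (\<forall>x\<in>(\<lambda>k. - k0 + k) ` K. 0 \<le> d \<bullet> x)"
      by (rule separating_hyperplane_set_0)
    then obtain d where d: "d \<noteq> 0" and d_image: "\<forall>x\<in>(\<lambda>k. - k0 + k) ` K. 0 \<le> d \<bullet> x"
      by (elim exE conjE)
    have sep: "0 \<le> d \<bullet> (- k0 + k)" if "k \<in> K" for k
      by (rule bspec[OF d_image imageI[OF that]])
    \<comment> \<open>A negative value on the cone \<open>K\<close> could be scaled below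
      \<open>d \<bullet> k0\<close>.\<close>
    have nonneg: "d \<bullet> k \<ge> 0" if k: "k \<in> K" for k
    proof (rule ccontr)
      assume neg: "\<not> d \<bullet> k \<ge> 0"
      define s where "s = (\<bar>d \<bullet> k0\<bar> + 1) / - (d \<bullet> k)"
      have "s \<ge> 0" using neg by (auto simp: s_def intro!: divide_nonneg_neg)
      moreover have "s * (d \<bullet> k) = - (\<bar>d \<bullet> k0\<bar> + 1)" using neg by (simp add: s_def)
      ultimately show False using sep[OF K_scale[OF k, of s]] by (simp add: inner_diff_right)
    qed
    have nonneg_f: "d \<bullet> f \<alpha> y \<beta> \<ge> 0" if "0 \<le> \<alpha>" "0 \<le> y" "0 \<le> \<beta>" for \<alpha> y \<beta>
      using that by (intro nonneg) (auto simp: K_def)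
    have "d $ j \<ge> 0" if "j \<notin> L" for j
    proof -
      have "f (axis j 1) 0 0 = axis j 1"
        using that by (auto simp: f_def vec_eq_iff axis_def zero_prod_def[symmetric])
      moreover have "0 \<le> (axis j 1 :: real ^ 'n)" by (simp add: less_eq_vec_def axis_def)
      ultimately show ?thesis using nonneg_f[of "axis j 1" 0 0] by (simp add: inner_axis)
    qed
    moreover have "(\<Sum>j\<in>UNIV. d $ j *\<^sub>R u (Some j)) \<in> nonpos_orthant"
    proof -
      define S where "S = (\<Sum>j\<in>UNIV. d $ j *\<^sub>R u (Some j))"
      have dS: "d \<bullet> f 0 y \<beta> = - (S \<bullet> (y, \<beta>))" for y \<beta>
      proof -
        have "f 0 y \<beta> = (\<chi> j. - (u (Some j) \<bullet> (y, \<beta>)))" by (simp add: f_def vec_eq_iff)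
        then show ?thesis by (simp add: S_def inner_vec_def[of d] inner_sum_left sum_negf)
      qed
      have "fst S $ i \<le> 0" for i
      proof -
        have "0 \<le> (axis i 1 :: real ^ 'm)" by (simp add: less_eq_vec_def axis_def)
        then show ?thesis
          using nonneg_f[of 0 "axis i 1" 0] dS[of "axis i 1" 0] by (simp add: inner_prod_def inner_axis)
      qed
      moreover have "snd S \<le> 0"
        using nonneg_f[of 0 0 1] dS[of 0 1] by (simp add: inner_prod_def)
      ultimately show ?thesis by (simp add: nonpos_orthant_def S_def)
    qed
    ultimately show False using no_direction[OF d] by blast
  qed
  then obtain \<alpha> y \<beta> where k0: "k0 = f \<alpha> y \<beta>" "0 \<le> \<alpha>" "0 \<le> y" "0 \<le> \<beta>"
    unfolding K_def by blast
  have eq: "u (Some j) \<bullet> (y, \<beta> + 1) = (if j \<in> L then 0 else \<alpha> $ j + 1)" for j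
  proof -
    have "k0 $ j = f \<alpha> y \<beta> $ j" using k0(1) by simp
    then show ?thesis by (auto simp: k0_def f_def inner_prod_def algebra_simps split: if_splits)
  qed
  show ?thesis
  proof (intro exI[of _ "(y, \<beta> + 1)"] conjI ballI)
    fix v assume "v \<in> UNIV - Some ` L"
    then show "u v \<bullet> (y, \<beta> + 1) > 0"
      using k0(2,4) eq by (cases v) (auto simp: None inner_prod_def less_eq_vec_def add_nonneg_pos)
  qed (auto simp: eq)
qed

text \<open>Stability permits one perturbation for all loadouts at once. It first shifts the lifted
  columns so that \<open>{None}\<close> becomes a face, then moves them into general
  position.\<close>

lemma design_config:
  fixes A :: "real ^ 'n ^ 'm" and c :: "real ^ 'n"
  assumes card: "CARD('n) \<ge> CARD('m)" and "design A c"
  obtains u :: "'n option \<Rightarrow> (real ^ 'm) \<times> real" where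
    "vector_config UNIV u CARD('m)" "vector_config.face UNIV u {None}"
    "\<And>L. loadout A c L \<Longrightarrow> vector_config.face UNIV u (Some ` L)"
proof -
  define stable where "stable L \<delta> \<longleftrightarrow> \<delta> > 0 \<and> (\<forall>u. (\<forall>j. norm (u j - lift_column A c j) < \<delta>) \<longrightarrow>
    (\<forall>d. d \<noteq> 0 \<longrightarrow> (\<forall>j. j \<notin> L \<longrightarrow> d $ j \<ge> 0) \<longrightarrow> (\<Sum>j\<in>UNIV. d $ j *\<^sub>R u j) \<notin> nonpos_orthant))" for L \<delta>
  have "\<exists>\<delta>. stable L \<delta>" if "loadout A c L" for L
    using loadout_stable[OF that] by (auto simp: stable_def)
  then obtain \<delta>L where \<delta>L: "\<And>L. loadout A c L \<Longrightarrow> stable L (\<delta>L L)" by metis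
  \<comment> \<open>There are finitely many loadouts; the inserted 1 covers the case that there are
    none.\<close>
  define \<delta> where "\<delta> = Min (insert 1 (\<delta>L ` {L. loadout A c L}))"
  have \<delta>: "\<delta> > 0" "\<And>L. loadout A c L \<Longrightarrow> \<delta> \<le> \<delta>L L"
    using \<delta>L by (auto simp: \<delta>_def stable_def)
  \<comment> \<open>As \<open>A\<close> is nonnegative, all lifted columns have nonnegative product
    with \<open>e\<close>; a shift along \<open>e\<close> makes these products positive, while
    \<open>(0, 1)\<close> stays orthogonal to \<open>e\<close>. So \<open>e\<close> certifies the
    face \<open>{None}\<close>.\<close>
  define e :: "(real ^ 'm) \<times> real" where "e = (1, 0)"
  have "e \<noteq> 0" by (simp add: e_def zero_prod_def)
  define \<eta> where "\<eta> = \<delta> / (2 * norm e)"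
  have \<eta>: "\<eta> > 0" "norm (\<eta> *\<^sub>R e) = \<delta> / 2" using \<delta>(1) \<open>e \<noteq> 0\<close> by (auto simp: \<eta>_def)
  define b where "b v = (case v of None \<Rightarrow> 0 | Some j \<Rightarrow> lift_column A c j + \<eta> *\<^sub>R e)" for v
  \<comment> \<open>The first bound leaves half of \<delta> for the shift; the second keeps the
    perturbation from undoing the positivity gained by the shift.\<close>
  define \<epsilon> where "\<epsilon> = min (\<delta> / 2) (\<eta> * norm e)"
  have "\<epsilon> > 0" using \<delta>(1) \<eta> \<open>e \<noteq> 0\<close> by (simp add: \<epsilon>_def)
  have ins: "insert None (range Some) = (UNIV :: 'n option set)" using UNIV_option_conv by blast
  obtain u :: "'n option \<Rightarrow> (real ^ 'm) \<times> real" where u: "u None = (0, 1)" "\<And>j. norm (u (Some j) - b (Some j)) < \<epsilon>"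
    and indep: "\<And>S. card S \<le> DIM((real ^ 'm) \<times> real) \<Longrightarrow> inj_on u S \<and> independent (u ` S)"
    using generic_perturbation[of "range Some" None "(0, 1)" \<epsilon> b] \<open>\<epsilon> > 0\<close>
    unfolding ins by (auto simp: zero_prod_def)
  have DIM: "DIM((real ^ 'm) \<times> real) = Suc CARD('m)" by simp
  have ue: "u (Some j) \<bullet> e > 0" for j
  proof -
    have "\<bar>(u (Some j) - b (Some j)) \<bullet> e\<bar> \<le> norm (u (Some j) - b (Some j)) * norm e"
      by (rule Cauchy_Schwarz_ineq2)
    also have "\<dots> < (\<eta> * norm e) * norm e"
      using u(2)[of j] \<open>e \<noteq> 0\<close> by (intro mult_strict_right_mono) (auto simp: \<epsilon>_def)
    also have "\<dots> = (\<eta> *\<^sub>R e) \<bullet> e" by (simp add: norm_eq_sqrt_inner)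
    finally have 1: "(u (Some j) - b (Some j)) \<bullet> e > - ((\<eta> *\<^sub>R e) \<bullet> e)" by linarith
    have "lift_column A c j \<bullet> e = (\<Sum>i\<in>UNIV. A $ i $ j)"
      by (simp add: lift_column_def e_def inner_prod_def inner_vec_def column_def)
    also have "\<dots> \<ge> 0"
      using assms(2) by (intro sum_nonneg) (auto simp: design_def less_eq_vec_def)
    finally have "b (Some j) \<bullet> e \<ge> (\<eta> *\<^sub>R e) \<bullet> e" by (simp add: b_def inner_add_left)
    with 1 show ?thesis by (simp add: inner_diff_left)
  qed
  show thesis
  proof (rule that)
    show config: "vector_config UNIV u CARD('m)"
    proof
      fix S :: "'n option set" and z
      assume "card S = Suc CARD('m)" "\<And>j. j \<in> S \<Longrightarrow> u j \<bullet> z = 0"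
      then show "z = 0" using indep[of S] DIM
        by (intro orthogonal_to_full_independent_family[of u S]) auto
    qed (use card in \<open>auto simp: card_UNIV_option\<close>)
    interpret vector_config UNIV u "CARD('m)" by (rule config)
    have "\<forall>v\<in>UNIV - {None}. u v \<bullet> e > 0" using ue by (metis DiffE option.exhaust singletonI)
    moreover have "u None \<bullet> e = 0" by (simp add: u(1) e_def inner_prod_def)
    ultimately show "face {None}" unfolding face_def by blast
    fix L assume L: "loadout A c L"
    have "norm (u (Some j) - lift_column A c j) < \<delta>L L" for j
    proof -
      have "u (Some j) - lift_column A c j = (u (Some j) - b (Some j)) + \<eta> *\<^sub>R e" by (simp add: b_def)
      then have "norm (u (Some j) - lift_column A c j) \<le> norm (u (Some j) - b (Some j)) + norm (\<eta> *\<^sub>R e)"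
        by (metis norm_triangle_ineq)
      also have "\<dots> < \<delta>" using u(2)[of j] \<eta> by (simp add: \<epsilon>_def)
      finally show ?thesis using \<delta>(2)[OF L] by simp
    qed
    moreover have "(\<forall>j. norm (u (Some j) - lift_column A c j) < \<delta>L L) \<longrightarrow>
        (\<forall>d. d \<noteq> 0 \<longrightarrow> (\<forall>j. j \<notin> L \<longrightarrow> d $ j \<ge> 0) \<longrightarrow>
          (\<Sum>j\<in>UNIV. d $ j *\<^sub>R u (Some j)) \<notin> nonpos_orthant)"
      using \<delta>L[OF L] unfolding stable_def by (elim conjE) (rule spec[where x = "\<lambda>j. u (Some j)"])
    ultimately have "(\<Sum>j\<in>UNIV. d $ j *\<^sub>R u (Some j)) \<notin> nonpos_orthant"
      if "d \<noteq> 0" "\<forall>j. j \<notin> L \<longrightarrow> d $ j \<ge> 0" for d using that by simp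
    from dual_certificate[OF u(1) this] show "face (Some ` L)" unfolding face_def by auto
  qed
qed

section \<open>Cyclic polytopes\<close>

locale moment_config =
  fixes e :: "'m::finite \<Rightarrow> nat" and T :: "real set"
  assumes e: "bij_betw e UNIV {1..CARD('m)}" and finite_T: "finite T" and card_T: "CARD('m) < card T"
begin

text \<open>The homogenised point of the curve: \<open>u t \<bullet> z\<close> is the value at
  \<open>t\<close> of a polynomial of degree at most \<open>CARD('m)\<close> with constant term
  \<open>snd z\<close>.\<close>

definition u :: "real \<Rightarrow> (real ^ 'm) \<times> real" where
  "u t = (moment_curve e t, 1)"

lemma inner_u: "u t \<bullet> z = snd z + (\<Sum>i\<in>UNIV. fst z $ i * t ^ e i)"
  by (simp add: u_def moment_curve_def inner_prod_def inner_vec_def mult.commute)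

lemma e_inj: "e i = e j \<longleftrightarrow> i = j" and e_pos: "e i > 0" and e_le: "e i \<le> CARD('m)"
proof -
  show "e i = e j \<longleftrightarrow> i = j" using e by (auto simp: bij_betw_def inj_on_def)
  have "e i \<in> {1..CARD('m)}" using e by (auto simp: bij_betw_def)
  then show "e i > 0" "e i \<le> CARD('m)" by auto
qed

text \<open>A polynomial of degree at most \<open>CARD('m)\<close> with more roots than that is
  zero, and its coefficients are the entries of \<open>z\<close>.\<close>

lemma generic_u:
  assumes "finite S" "CARD('m) < card S" "\<And>t. t \<in> S \<Longrightarrow> u t \<bullet> z = 0"
  shows "z = 0"
proof -
  define P where "P = monom (snd z) 0 + (\<Sum>i\<in>UNIV. monom (fst z $ i) (e i))"
  have poly_P: "poly P t = u t \<bullet> z" for t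
    by (simp add: P_def inner_u poly_sum poly_monom)
  have "degree P \<le> CARD('m)"
    unfolding P_def by (intro degree_add_le degree_sum_le) (auto intro: order_trans[OF degree_monom_le] e_le)
  have "P = 0"
  proof (rule ccontr)
    assume "P \<noteq> 0"
    have "card S \<le> card {t. poly P t = 0}"
      using assms(3) poly_P by (intro card_mono poly_roots_finite[OF \<open>P \<noteq> 0\<close>]) auto
    also have "\<dots> \<le> CARD('m)" using card_poly_roots_bound[OF \<open>P \<noteq> 0\<close>] \<open>degree P \<le> CARD('m)\<close> by simp
    finally show False using assms(2) by simp
  qed
  moreover have "coeff P 0 = snd z"
    using e_pos by (simp add: P_def coeff_sum less_imp_neq[THEN not_sym])
  moreover have "coeff P (e i) = fst z $ i" for i
    using e_pos[of i] by (simp add: P_def coeff_sum e_inj)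
  ultimately show ?thesis by (auto simp: prod_eq_iff vec_eq_iff)
qed

lemma poly_as_inner:
  assumes "degree P \<le> CARD('m)"
  shows "u t \<bullet> (\<chi> i. coeff P (e i), coeff P 0) = poly P t"
proof -
  have "poly P t = (\<Sum>k\<le>CARD('m). coeff P k * t ^ k)"
    unfolding poly_altdef using assms by (intro sum.mono_neutral_left) (auto simp: coeff_eq_0)
  also have "{..CARD('m)} = insert 0 {1..CARD('m)}" by auto
  also have "(\<Sum>k\<in>insert 0 {1..CARD('m)}. coeff P k * t ^ k) =
      coeff P 0 + (\<Sum>k\<in>{1..CARD('m)}. coeff P k * t ^ k)" by simp
  also have "(\<Sum>k\<in>{1..CARD('m)}. coeff P k * t ^ k) = (\<Sum>i\<in>UNIV. coeff P (e i) * t ^ e i)"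
    by (rule sum.reindex_bij_betw[OF e, symmetric])
  finally show ?thesis by (simp add: inner_u)
qed

sublocale vector_config T u "CARD('m)"
proof
  show "z = 0" if "S \<subseteq> T" "card S = Suc CARD('m)" "\<And>j. j \<in> S \<Longrightarrow> u j \<bullet> z = 0" for S z
    using that finite_T finite_subset by (intro generic_u[of S]) auto
qed (use finite_T card_T in auto)

text \<open>The product of the squares \<open>(t - l)\<^sup>2\<close> over \<open>l \<in> L\<close>
  vanishes exactly on \<open>L\<close>, is positive elsewhere, and has degree at most
  \<open>2 * card L\<close>.\<close>

lemma neighborly:
  assumes "L \<subseteq> T" "card L \<le> CARD('m) div 2"
  shows "face L"
proof -
  have fin: "finite L" using assms finite_T finite_subset by blast
  define P where "P = (\<Prod>l\<in>L. [:- l, 1:] ^ 2)"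
  have "degree P \<le> (\<Sum>l\<in>L. degree ([:- l, 1:] ^ 2))"
    unfolding P_def using degree_prod_sum_le[OF fin, of "\<lambda>l. [:- l, 1:] ^ 2"] by (simp add: o_def)
  also have "\<dots> = 2 * card L" by (simp add: degree_power_eq)
  finally have deg: "degree P \<le> CARD('m)" using assms(2) by linarith
  have poly_P: "poly P t = (\<Prod>l\<in>L. (t - l)\<^sup>2)" for t by (simp add: P_def poly_prod)
  show ?thesis
    unfolding face_def
  proof (intro conjI exI[of _ "(\<chi> i. coeff P (e i), coeff P 0)"] ballI)
    show "u t \<bullet> (\<chi> i. coeff P (e i), coeff P 0) = 0" if "t \<in> L" for t
      unfolding poly_as_inner[OF deg] poly_P using that fin by (auto simp: prod_zero_iff)
    show "u t \<bullet> (\<chi> i. coeff P (e i), coeff P 0) > 0" if "t \<in> T - L" for t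
      unfolding poly_as_inner[OF deg] poly_P using that by (intro prod_pos) auto
  qed (rule assms)
qed

lemma inj_moment_curve: "inj_on (moment_curve e) S"
proof (rule inj_onI)
  fix s t assume "moment_curve e s = moment_curve e t"
  moreover obtain i where "e i = 1"
    using e by (metis One_nat_def Suc_leI atLeastAtMost_iff bij_betw_iff_bijections order_refl zero_less_card_finite)
  ultimately show "s = t" by (metis moment_curve_def power_one_right vec_lambda_beta)
qed

section \<open>Geometric faces of the cyclic polytope\<close>

text \<open>The certificate \<open>z\<close> is the supporting hyperplane
  \<open>fst z \<bullet> x = - snd z\<close>, with the remaining points strictly on one side. The
  third claim recovers \<open>L\<close> from its hull.\<close>

lemma hull_face:
  assumes L: "face L" "card L = k" "k \<le> CARD('m)" "k > 0"
  shows "convex hull (moment_curve e ` L) face_of convex hull (moment_curve e ` T)"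
    and "aff_dim (convex hull (moment_curve e ` L)) = int (k - 1)"
    and "\<And>t. t \<in> T \<Longrightarrow> moment_curve e t \<in> convex hull (moment_curve e ` L) \<Longrightarrow> t \<in> L"
proof -
  let ?\<gamma> = "moment_curve e"
  from L(1) obtain z where sub: "L \<subseteq> T" and z: "\<And>t. t \<in> L \<Longrightarrow> u t \<bullet> z = 0"
    "\<And>t. t \<in> T - L \<Longrightarrow> u t \<bullet> z > 0" unfolding face_def by blast
  have fin: "finite L" using sub finite_T finite_subset by blast
  have uz: "u t \<bullet> z = fst z \<bullet> ?\<gamma> t + snd z" for t
    by (simp add: u_def inner_prod_def inner_commute)
  have aff: "affine hull (?\<gamma> ` L) \<subseteq> {x. fst z \<bullet> x = - snd z}"
    using z(1) by (intro hull_minimal affine_hyperplane) (auto simp: uz eq_neg_iff_add_eq_0)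
  have conv: "convex hull (?\<gamma> ` (T - L)) \<subseteq> {x. fst z \<bullet> x > - snd z}"
    using z(2) by (intro hull_minimal convex_halfspace_gt) (force simp: uz)
  have im: "?\<gamma> ` T - ?\<gamma> ` L = ?\<gamma> ` (T - L)"
    using inj_on_image_set_diff[OF inj_moment_curve[of T], of T L] sub by auto
  show "convex hull (?\<gamma> ` L) face_of convex hull (?\<gamma> ` T)"
    using aff conv finite_T sub by (intro face_of_convex_hulls) (auto simp: im, force)
  show "t \<in> L" if "t \<in> T" "?\<gamma> t \<in> convex hull (?\<gamma> ` L)" for t
  proof (rule ccontr)
    assume "t \<notin> L"
    then have "fst z \<bullet> ?\<gamma> t > - snd z" using z(2)[of t] that uz[of t] by auto
    then show False using that(2) convex_hull_subset_affine_hull aff by fastforce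
  qed
  have "\<not> affine_dependent (?\<gamma> ` L)"
  proof
    assume "affine_dependent (?\<gamma> ` L)"
    then obtain U where U: "sum U (?\<gamma> ` L) = 0" "\<exists>v\<in>?\<gamma> ` L. U v \<noteq> 0" "(\<Sum>v\<in>?\<gamma> ` L. U v *\<^sub>R v) = 0"
      using fin by (auto simp: affine_dependent_explicit_finite)
    define a where "a t = U (?\<gamma> t)" for t
    have a: "sum a L = 0" "(\<Sum>t\<in>L. a t *\<^sub>R ?\<gamma> t) = 0"
      using U(1,3) inj_moment_curve[of L] by (simp_all add: sum.reindex a_def)
    obtain s where s: "s \<in> L" "a s \<noteq> 0" using U(2) by (auto simp: a_def)
    \<comment> \<open>Pairing the supposed dependency with this \<open>y\<close> isolates the
      nonzero coefficient \<open>a s\<close>.\<close>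
    obtain y where y: "\<forall>t\<in>L. u t \<bullet> y = (if t = s then 1 else 0)"
      using ex_prescribed[OF sub, of "\<lambda>t. if t = s then 1 else 0"] L by auto
    have "(\<Sum>t\<in>L. a t *\<^sub>R u t) = (\<Sum>t\<in>L. (a t *\<^sub>R ?\<gamma> t, a t))"
      by (simp add: u_def)
    also have "\<dots> = 0" using a by (simp add: prod_eq_iff fst_sum snd_sum)
    finally have "0 = (\<Sum>t\<in>L. a t *\<^sub>R u t) \<bullet> y" by simp
    also have "\<dots> = (\<Sum>t\<in>L. a t * (if t = s then 1 else 0))"
      unfolding inner_sum_left using y by (intro sum.cong) auto
    also have "\<dots> = a s" using s(1) fin by (simp add: if_distrib cong: if_cong)
    finally show False using s(2) by simp
  qed
  then have "int (card (?\<gamma> ` L)) = aff_dim (?\<gamma> ` L) + 1" by (rule aff_dim_affine_independent)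
  then show "aff_dim (convex hull (?\<gamma> ` L)) = int (k - 1)"
    using L by (simp add: aff_dim_convex_hull card_image[OF inj_moment_curve])
qed

text \<open>An injection of combinatorial faces into geometric ones suffices, as the final estimate
  bounds loadouts from above by the face count.\<close>

lemma card_faces_le_face_count:
  assumes k: "0 < k" "k \<le> CARD('m)"
  shows "card (faces k) \<le> face_count (k - 1) (convex hull (moment_curve e ` T))"
  unfolding face_count_def
proof (rule card_inj_on_le[where f = "\<lambda>L. convex hull (moment_curve e ` L)"])
  show "inj_on (\<lambda>L. convex hull (moment_curve e ` L)) (faces k)"
  proof (rule inj_onI)
    have sub: "L \<subseteq> L'" if "L \<in> faces k" "L' \<in> faces k"
      "convex hull (moment_curve e ` L) = convex hull (moment_curve e ` L')" for L L'
    proof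
      fix t assume "t \<in> L"
      then have "t \<in> T" "moment_curve e t \<in> convex hull (moment_curve e ` L)"
        using that(1) by (auto simp: faces_def face_def hull_inc)
      then show "t \<in> L'" using hull_face(3)[of L' k t] that k by (auto simp: faces_def)
    qed
    show "L = L'" if "L \<in> faces k" "L' \<in> faces k"
      "convex hull (moment_curve e ` L) = convex hull (moment_curve e ` L')" for L L'
      using sub[OF that] sub[OF that(2,1) that(3)[symmetric]] by (rule subset_antisym)
  qed
  show "(\<lambda>L. convex hull (moment_curve e ` L)) ` faces k \<subseteq>
      {F. F face_of convex hull (moment_curve e ` T) \<and> aff_dim F = int (k - 1)}"
    using hull_face(1,2) k by (auto simp: faces_def)
  have "finite {F. F face_of convex hull (moment_curve e ` T)}"
    using finite_T by (intro finite_polytope_faces polytope_convex_hull) auto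
  then show "finite {F. F face_of convex hull (moment_curve e ` T) \<and> aff_dim F = int (k - 1)}"
    by (rule rev_finite_subset) auto
qed

end

section \<open>Combination of the estimates\<close>

theorem theorem1:
  fixes A :: "real ^ 'n ^ 'm" and c :: "real ^ 'n" and k :: nat
    and C :: "(real ^ 'm) set"
  assumes "CARD('n) > CARD('m)" and "CARD('m) \<ge> k" and "k \<ge> 2"
    and "design A c"
    and "cyclic_polytope (CARD('n) + 1) C"
  shows "int (card (loadouts k A c)) \<le>
    int (face_count (k - 1) C) - int (CARD('m) choose (k - 1))"
proof -
  obtain e :: "'m \<Rightarrow> nat" and T where e: "bij_betw e UNIV {1..CARD('m)}"
    and T: "finite T" "card T = CARD('n) + 1" and C: "C = convex hull (moment_curve e ` T)"
    using assms(5) unfolding cyclic_polytope_def by auto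
  interpret Y: moment_config e T
    using e T assms(1) by unfold_locales auto
  obtain u :: "'n option \<Rightarrow> (real ^ 'm) \<times> real" where
    config: "vector_config UNIV u CARD('m)" and None: "vector_config.face UNIV u {None}"
    and loadout: "\<And>L. loadout A c L \<Longrightarrow> vector_config.face UNIV u (Some ` L)"
    using design_config[OF less_imp_le[OF assms(1)] assms(4)] by blast
  interpret X: vector_config UNIV u "CARD('m)" by (rule config)
  \<comment> \<open>\<open>Some\<close> embeds the \<open>k\<close>-loadouts into the faces of size
    \<open>k\<close> that avoid the vertex at infinity.\<close>
  have "card (loadouts k A c) \<le> card (X.faces k - {L\<in>X.faces k. {None} \<subseteq> L})"
  proof (rule card_inj_on_le[where f = "\<lambda>L. Some ` L"])
    show "inj_on (\<lambda>L. Some ` L) (loadouts k A c)"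
      by (rule inj_onI) (simp add: inj_image_eq_iff)
    show "(\<lambda>L. Some ` L) ` loadouts k A c \<subseteq> X.faces k - {L\<in>X.faces k. {None} \<subseteq> L}"
      using loadout by (auto simp: loadouts_def X.faces_def card_image)
  qed (simp add: X.finite_faces)
  also have "\<dots> = card (X.faces k) - card {L\<in>X.faces k. {None} \<subseteq> L}"
    using X.finite_faces by (intro card_Diff_subset) auto
  finally have "card (loadouts k A c) + card {L\<in>X.faces k. {None} \<subseteq> L} \<le> card (X.faces k)"
    using card_mono[OF X.finite_faces[of k], of "{L\<in>X.faces k. {None} \<subseteq> L}"] by auto
  \<comment> \<open>With \<open>S = {None}\<close> the bound
    \<open>(Suc m - card S) choose (k - card S)\<close> becomes the subtracted binomial
    coefficient.\<close>
  moreover have "CARD('m) choose (k - 1) \<le> card {L\<in>X.faces k. {None} \<subseteq> L}"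
    using X.card_faces_containing[OF None _ assms(2)] assms(3) by simp
  moreover have "card (X.faces k) \<le> card (Y.faces k)"
    using Y.neighborly assms(2) T
    by (intro upper_bound[OF config Y.vector_config_axioms]) (auto simp: card_UNIV_option)
  moreover have "card (Y.faces k) \<le> face_count (k - 1) C"
    unfolding C using assms(2,3) by (intro Y.card_faces_le_face_count) auto
  ultimately show ?thesis by linarith
qed

end
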